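(* Let $G$ be a finite group and let $p$ be a prime. Then $\mathrm{Pr}_p(G) > \frac{p^2+p-1}{p^3}$ if and only if $G$ has a normal and abelian Sylow $p$-subgroup.
   Context: For a finite group $G$ and a prime $p$, $G_p$ denotes the set of $p$-elements of $G$, i.e. the elements of order $p^m$ for some $m \geq 0$ (so $1 \in G_p$), and $$\mathrm{Pr}_p(G) = \frac{|\{(x,y) \in G_p \times G_p : xy = yx\}|}{|G_p|^2}$$ is the probability that two random $p$-elements of $G$ commute. *)

theory Defs
  imports Complex_Main "HOL-Algebra.Algebra"
begin

definition p_elements :: "('a, 'b) monoid_scheme \<Rightarrow> nat \<Rightarrow> 'a set" where
  "p_elements G p = {x \<in> carrier G. \<exists>m. group.ord G x = p ^ m}"

definition commuting_prob :: "('a, 'b) monoid_scheme \<Rightarrow> nat \<Rightarrow> real" where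
  "commuting_prob G p =
     real (card {(x, y) \<in> p_elements G p \<times> p_elements G p. x \<otimes>\<^bsub>G\<^esub> y = y \<otimes>\<^bsub>G\<^esub> x})
     / real (card (p_elements G p)) ^ 2"

definition sylow_subgroup :: "('a, 'b) monoid_scheme \<Rightarrow> nat \<Rightarrow> 'a set \<Rightarrow> bool" where
  "sylow_subgroup G p P \<longleftrightarrow> subgroup P G \<and> card P = p ^ multiplicity p (order G)"

end

theory Submission
  imports Defs
begin

text \<open>
  Let \<open>N\<close> be the number of p-elements. The key fact is that a p-element \<open>x\<close> outside \<open>O\<^sub>p(G)\<close>
  commutes with at most \<open>N/p\<close> of them. Take a subgroup \<open>H\<close> of minimal order containing a conjugate \<open>z\<close>
  of \<open>x\<close> with \<open>z \<notin> O\<^sub>p(H)\<close>. As in Wielandt's zipper lemma, the maximal intersections of the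
  \<open>H\<close>-class of \<open>z\<close> with proper subgroups of \<open>H\<close> are pairwise disjoint, and \<open>z\<close> stabilizes only the
  one containing it; so there are at least \<open>p + 1\<close> of them, and representatives pairwise generate \<open>H\<close>.
  The centralizers of these \<open>p + 1\<close> conjugates therefore pairwise intersect in \<open>C\<^sub>G(H)\<close>, and a count
  of p-elements in their union gives the bound. The same conjugates, with \<open>\<langle>a\<rangle> O\<^sub>p(G)\<close> in
  place of the centralizers, give \<open>p\<^sup>2 |O\<^sub>p(G)| \<le> N\<close> unless all p-elements lie in \<open>O\<^sub>p(G)\<close>.
  Elements of \<open>O\<^sub>p(G)\<close> are then so few that the trivial bound \<open>N\<close> suffices for them. If all p-elements
  lie in \<open>O\<^sub>p(G)\<close> and it is not abelian, its centre plays the role of \<open>O\<^sub>p(G)\<close> in this count.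
\<close>

section \<open>Conjugation and p-elements\<close>

locale finite_group_prime = group G for G (structure) +
  fixes p :: nat
  assumes fin: "finite (carrier G)" and prime_p: "Factorial_Ring.prime p"
begin

abbreviation P :: "'a set" where "P \<equiv> p_elements G p"

definition cj :: "'a \<Rightarrow> 'a \<Rightarrow> 'a" where
  "cj g x = g \<otimes> x \<otimes> inv g"

lemma inv_cancel [simp]:
  assumes "g \<in> carrier G" "x \<in> carrier G"
  shows "inv g \<otimes> (g \<otimes> x) = x" "g \<otimes> (inv g \<otimes> x) = x"
  using assms by (simp_all flip: m_assoc)

lemma cj_closed [simp]: "g \<in> carrier G \<Longrightarrow> x \<in> carrier G \<Longrightarrow> cj g x \<in> carrier G"
  by (simp add: cj_def)

lemma cj_one [simp]: "x \<in> carrier G \<Longrightarrow> cj \<one> x = x"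
  by (simp add: cj_def)

lemma cj_one_right [simp]: "g \<in> carrier G \<Longrightarrow> cj g \<one> = \<one>"
  by (simp add: cj_def)

lemma cj_comp: "g \<in> carrier G \<Longrightarrow> h \<in> carrier G \<Longrightarrow> x \<in> carrier G \<Longrightarrow> cj (g \<otimes> h) x = cj g (cj h x)"
  by (simp add: cj_def m_assoc inv_mult_group)

lemma cj_mult: "g \<in> carrier G \<Longrightarrow> x \<in> carrier G \<Longrightarrow> y \<in> carrier G \<Longrightarrow> cj g (x \<otimes> y) = cj g x \<otimes> cj g y"
  by (simp add: cj_def m_assoc)

lemma cj_inv: "g \<in> carrier G \<Longrightarrow> x \<in> carrier G \<Longrightarrow> cj g (inv x) = inv (cj g x)"
  by (simp add: cj_def m_assoc inv_mult_group)

lemma cj_pow: "g \<in> carrier G \<Longrightarrow> x \<in> carrier G \<Longrightarrow> cj g (x [^] (n::nat)) = cj g x [^] n"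
  by (induction n) (simp_all add: cj_mult)

lemma cj_cancel [simp]:
  assumes "g \<in> carrier G" "x \<in> carrier G"
  shows "cj (inv g) (cj g x) = x" "cj g (cj (inv g) x) = x"
  using assms by (simp_all flip: cj_comp)

lemma cj_inj: "g \<in> carrier G \<Longrightarrow> inj_on (cj g) (carrier G)"
  by (metis cj_cancel(1) inj_onI)

lemma cj_commute: "g \<in> carrier G \<Longrightarrow> x \<in> carrier G \<Longrightarrow> g \<otimes> x = x \<otimes> g \<Longrightarrow> cj g x = x"
  by (simp add: cj_def m_assoc)

lemma cj_closed_subgroup: "subgroup L G \<Longrightarrow> g \<in> L \<Longrightarrow> x \<in> L \<Longrightarrow> cj g x \<in> L"
  by (simp add: cj_def subgroup.m_closed subgroup.m_inv_closed)

lemma pow_closed_subgroup: "subgroup L G \<Longrightarrow> x \<in> L \<Longrightarrow> x [^] (n::nat) \<in> L"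
  by (induction n) (simp_all add: subgroup.m_closed subgroup.one_closed)

section \<open>Powers, roots and conjugates of p-elements\<close>

lemma mem_P_iff: "x \<in> P \<longleftrightarrow> x \<in> carrier G \<and> (\<exists>m. x [^] (p ^ m) = \<one>)"
proof -
  have "(\<exists>m. ord x = p ^ m) \<longleftrightarrow> (\<exists>m. x [^] (p ^ m) = \<one>)" if "x \<in> carrier G"
    using divides_primepow_nat[OF prime_p] pow_eq_id[OF that] by (metis dvd_refl)
  then show ?thesis unfolding p_elements_def by blast
qed

lemma P_carrier: "P \<subseteq> carrier G"
  by (auto simp: mem_P_iff)

lemma finite_P: "finite P"
  using P_carrier fin finite_subset by blast

lemma one_P: "\<one> \<in> P"
  by (simp add: mem_P_iff)

lemma P_pow: assumes "x \<in> P" shows "x [^] (n::nat) \<in> P"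
proof -
  obtain m where m: "x \<in> carrier G" "x [^] (p ^ m) = \<one>"
    using assms mem_P_iff by auto
  have "(x [^] n) [^] (p ^ m) = (x [^] (p ^ m)) [^] n"
    using m(1) by (simp add: nat_pow_pow mult.commute)
  then show ?thesis using m mem_P_iff by auto
qed

lemma P_root: assumes "x \<in> carrier G" "x [^] (p ^ n) \<in> P" shows "x \<in> P"
  using assms by (auto simp: mem_P_iff nat_pow_pow simp flip: power_add)

lemma P_cj: "x \<in> P \<Longrightarrow> g \<in> carrier G \<Longrightarrow> cj g x \<in> P"
  unfolding mem_P_iff by (metis cj_closed cj_one_right cj_pow)

text \<open>As \<open>k\<close> is invertible modulo the order of \<open>x\<close>, a power of
  \<open>p\<close>, some power of \<open>x [^] k\<close> is \<open>x\<close> itself.\<close>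

lemma coprime_pow_mem:
  assumes C: "subgroup C G" and x: "x \<in> P" and xk: "x [^] (k::nat) \<in> C" and k: "coprime k p"
  shows "x \<in> C"
proof -
  obtain m where m: "x \<in> carrier G" "x [^] (p ^ m) = \<one>"
    using x mem_P_iff by auto
  have "k \<noteq> 0" using k prime_p by (intro notI) auto
  then obtain a b where ab: "k * a = p ^ m * b + gcd k (p ^ m)"
    using bezout_nat by blast
  have "(x [^] k) [^] a = x [^] (p ^ m * b + 1)"
    using m k ab by (simp add: nat_pow_pow)
  also have "\<dots> = (x [^] (p ^ m)) [^] b \<otimes> x"
    using m(1) by (simp add: nat_pow_pow)
  also have "\<dots> = x"
    using m by simp
  finally have "x = (x [^] k) [^] a" by simp
  then show ?thesis using pow_closed_subgroup[OF C xk] by metis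
qed

text \<open>The \<open>p\<close> translates of \<open>S\<close> by powers of \<open>x\<close> are
  disjoint: an overlap would put some \<open>x [^] (j - i)\<close> with \<open>0 < j - i < p\<close>
  into \<open>C\<close>, and then \<open>x\<close> as well. \<open>S\<close> and \<open>T\<close>
  are mere sets because a later count uses sets of p-elements that are not known to be
  subgroups.\<close>

lemma cosets_card:
  assumes C: "subgroup C G" and x: "x \<in> P" "x \<notin> C" and S: "S \<subseteq> C"
    and T: "finite T" "\<And>i s. i < p \<Longrightarrow> s \<in> S \<Longrightarrow> x [^] i \<otimes> s \<in> T"
  shows "p * card S \<le> card T"
proof -
  have xc: "x \<in> carrier G" using x P_carrier by auto
  have Sc: "S \<subseteq> carrier G" using S subgroup.subset[OF C] by auto
  have key: "i = j" if *: "i \<le> j" "j < p" "x [^] i \<otimes> s = x [^] j \<otimes> t" "s \<in> S" "t \<in> S" for i j :: nat and s t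
  proof (rule ccontr)
    assume "i \<noteq> j"
    have "x [^] j = x [^] i \<otimes> x [^] (j - i)"
      using * xc by (simp add: nat_pow_mult)
    then have "s = x [^] (j - i) \<otimes> t"
      using * Sc xc by (simp add: m_assoc subset_iff)
    then have "x [^] (j - i) = s \<otimes> inv t"
      using * Sc xc by (simp add: m_assoc subset_iff)
    moreover have "s \<otimes> inv t \<in> C"
      using * S C by (meson subgroup.m_closed subgroup.m_inv_closed subsetD)
    ultimately have "x [^] (j - i) \<in> C" by metis
    moreover have "coprime (j - i) p"
      using \<open>i \<noteq> j\<close> * prime_p nat_dvd_not_less[of "j - i" p]
      by (subst coprime_commute, intro prime_imp_coprime_nat) auto
    ultimately show False using coprime_pow_mem[OF C x(1)] x(2) by blast
  qed
  have "inj_on (\<lambda>(i,s). x [^] i \<otimes> s) ({..<p} \<times> S)"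
  proof (rule inj_onI)
    fix u v
    assume *: "u \<in> {..<p} \<times> S" "v \<in> {..<p} \<times> S"
      "(case u of (i, s) \<Rightarrow> x [^] i \<otimes> s) = (case v of (i, s) \<Rightarrow> x [^] i \<otimes> s)"
    then obtain i s j t where uv: "u = (i, s)" "v = (j, t)" "i < p" "j < p" "s \<in> S" "t \<in> S"
      "x [^] i \<otimes> s = x [^] j \<otimes> t"
      by auto
    then have "i = j" using key[of i j s t] key[of j i t s] by (cases "i \<le> j") auto
    then show "u = v" using uv xc Sc by (simp add: subset_iff)
  qed
  moreover have "(\<lambda>(i,s). x [^] i \<otimes> s) ` ({..<p} \<times> S) \<subseteq> T"
    using T by auto
  ultimately have "card ({..<p} \<times> S) \<le> card T"
    using card_inj_on_le T(1) by blast
  then show ?thesis by (simp add: card_cartesian_product)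
qed

text \<open>The translates of \<open>C\<close> by the first \<open>p\<close> powers of any element
  of \<open>R\<close> outside \<open>C\<close> all lie in \<open>R\<close>.\<close>

lemma index_ge_p:
  assumes "subgroup C G" "subgroup R G" "R \<subseteq> P" "C \<subset> R"
  shows "p * card C \<le> card R"
proof -
  obtain x where x: "x \<in> R" "x \<notin> C" using assms by blast
  show ?thesis
  proof (rule cosets_card[OF assms(1), of x])
    show "finite R" using assms finite_P finite_subset by blast
    show "x [^] i \<otimes> s \<in> R" if "s \<in> C" for i :: nat and s
      using that x assms pow_closed_subgroup by (meson psubsetE subgroup.m_closed subsetD)
  qed (use x assms in auto)
qed

text \<open>Cauchy's theorem, read off from Sylow's: another prime \<open>q\<close> dividing the
  order would give a nontrivial \<open>s\<close> in \<open>R\<close> with both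
  \<open>s [^] q\<close> and some \<open>s [^] (p ^ m)\<close> trivial.\<close>

lemma p_subgroup_card:
  assumes R: "subgroup R G" "R \<subseteq> P"
  shows "\<exists>n. card R = p ^ n"
proof (rule ccontr)
  assume no: "\<nexists>n. card R = p ^ n"
  have fR: "finite R" using R finite_P finite_subset by blast
  have pos: "card R > 0" using fR R(1) by (metis card_gt_0_iff emptyE subgroup.one_closed)
  interpret R: group "G\<lparr>carrier := R\<rparr>" using subgroup.subgroup_is_group[OF R(1)] is_group by simp
  obtain q where q: "Factorial_Ring.prime q" "q dvd card R" "q \<noteq> p"
  proof -
    obtain b where b: "card R = p ^ multiplicity p (card R) * b" "\<not> p dvd b"
      using pos prime_p by (metis multiplicity_decompose' not_prime_unit nat_neq_iff)
    then have "b \<noteq> 1" using no by auto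
    then obtain q where "Factorial_Ring.prime q" "q dvd b" using prime_factor_nat by blast
    then show ?thesis using that b by (metis dvd_mult)
  qed
  have "order (G\<lparr>carrier := R\<rparr>) = q ^ 1 * (card R div q)"
    using q by (simp add: order_def)
  then obtain S where S: "subgroup S (G\<lparr>carrier := R\<rparr>)" "card S = q ^ 1"
    using sylow_thm[OF q(1) R.group_axioms, of 1 "card R div q"] fR by auto
  have S': "subgroup S G" using S(1) R(1) incl_subgroup by blast
  have "S \<noteq> {\<one>}" using S(2) q by auto
  then obtain s where s: "s \<in> S" "s \<noteq> \<one>" using subgroup.one_closed[OF S'] by blast
  have "S \<subseteq> P" using S(1) R(2) subgroup.subset by fastforce
  then obtain m where m: "s [^] (p ^ m) = \<one>" "s \<in> carrier G" using s mem_P_iff by blast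
  interpret S: group "G\<lparr>carrier := S\<rparr>" using subgroup.subgroup_is_group[OF S'] is_group by simp
  have "s [^]\<^bsub>G\<lparr>carrier := S\<rparr>\<^esub> order (G\<lparr>carrier := S\<rparr>) = \<one>"
    using S.pow_order_eq_1[of s] s by simp
  then have "s [^] q = \<one>" using S(2) by (simp add: order_def nat_pow_consistent[symmetric])
  moreover have "coprime q (p ^ m)" using q prime_p by (simp add: primes_coprime)
  ultimately have "ord s = 1" using m pow_eq_id
    by (metis coprime_common_divisor_nat)
  then show False using s m ord_eq_1 by simp
qed

section \<open>Normalizers in p-subgroups\<close>

definition cs :: "'a \<Rightarrow> 'a set \<Rightarrow> 'a set" where
  "cs g S = cj g ` S"

lemma cs_comp: "g \<in> carrier G \<Longrightarrow> h \<in> carrier G \<Longrightarrow> S \<subseteq> carrier G \<Longrightarrow> cs (g \<otimes> h) S = cs g (cs h S)"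
  unfolding cs_def image_image by (intro image_cong) (auto simp: cj_comp)

lemma cs_closed: "g \<in> carrier G \<Longrightarrow> S \<subseteq> carrier G \<Longrightarrow> cs g S \<subseteq> carrier G"
  by (auto simp: cs_def)

lemma cs_one: "S \<subseteq> carrier G \<Longrightarrow> cs \<one> S = S"
  unfolding cs_def by force

lemma cs_cancel:
  assumes "g \<in> carrier G" "S \<subseteq> carrier G"
  shows "cs (inv g) (cs g S) = S" "cs g (cs (inv g) S) = S"
  using assms by (simp_all add: cs_one flip: cs_comp)

lemma card_cs: "g \<in> carrier G \<Longrightarrow> S \<subseteq> carrier G \<Longrightarrow> card (cs g S) = card S"
  unfolding cs_def by (meson card_image cj_inj inj_on_subset)

lemma cs_eqI:
  assumes "g \<in> carrier G" "S \<subseteq> carrier G" "\<And>x. x \<in> S \<Longrightarrow> cj g x \<in> S"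
  shows "cs g S = S"
  using assms fin by (intro card_subset_eq) (auto simp: card_cs finite_subset, auto simp: cs_def)

text \<open>Orbit-stabilizer: the fibres of the map from \<open>R\<close> onto the orbit are left
  translates of the stabilizer of \<open>S\<close>, so they all have the same size.\<close>

lemma card_orbit_dvd:
  assumes R: "subgroup R G" and S: "S \<subseteq> carrier G"
  shows "card ((\<lambda>g. cs g S) ` R) dvd card R"
proof -
  have Rc: "R \<subseteq> carrier G" using R subgroup.subset by blast
  then have fR: "finite R" using fin finite_subset by blast
  have "card {g \<in> R. cs g S = T} = card {g \<in> R. cs g S = S}" if T: "T \<in> (\<lambda>g. cs g S) ` R" for T
  proof -
    obtain h where h: "h \<in> R" "T = cs h S" using T by blast
    then have hc: "h \<in> carrier G" using Rc by auto
    have "bij_betw (\<lambda>g. h \<otimes> g) {g \<in> R. cs g S = S} {g \<in> R. cs g S = T}"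
    proof (rule bij_betw_byWitness[where f' = "\<lambda>g. inv h \<otimes> g"])
      show "(\<otimes>) h ` {g \<in> R. cs g S = S} \<subseteq> {g \<in> R. cs g S = T}"
        using h R Rc S hc by (auto simp: cs_comp subset_iff intro: subgroup.m_closed)
      show "(\<otimes>) (inv h) ` {g \<in> R. cs g S = T} \<subseteq> {g \<in> R. cs g S = S}"
        using h R Rc S hc by (auto simp: cs_comp cs_cancel subset_iff subgroup.m_closed subgroup.m_inv_closed)
    qed (use hc Rc in auto)
    then show ?thesis by (simp add: bij_betw_same_card)
  qed
  then have "card R = (\<Sum>T\<in>(\<lambda>g. cs g S) ` R. card {g \<in> R. cs g S = S})"
    using sum.image_gen[OF fR, of "\<lambda>_. 1::nat" "\<lambda>g. cs g S"] by simp
  then show ?thesis by simp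
qed

text \<open>The orbit size divides a power of \<open>p\<close>, and it exceeds 1 because
  \<open>S\<close> and \<open>cs h S\<close> are two points.\<close>

lemma p_dvd_card_orbit:
  assumes R: "subgroup R G" "R \<subseteq> P" and S: "S \<subseteq> carrier G" and h: "h \<in> R" "cs h S \<noteq> S"
  shows "p dvd card ((\<lambda>g. cs g S) ` R)"
proof -
  have fR: "finite R" using R finite_P finite_subset by blast
  obtain n where "card R = p ^ n" using p_subgroup_card R by blast
  then obtain i where i: "card ((\<lambda>g. cs g S) ` R) = p ^ i"
    using card_orbit_dvd[OF R(1) S] divides_primepow_nat[OF prime_p] by metis
  have "cs \<one> S \<in> (\<lambda>g. cs g S) ` R" "cs h S \<in> (\<lambda>g. cs g S) ` R"
    using subgroup.one_closed[OF R(1)] h by blast+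
  then have "{S, cs h S} \<subseteq> (\<lambda>g. cs g S) ` R" using S cs_one by auto
  then have "card {S, cs h S} \<le> card ((\<lambda>g. cs g S) ` R)" using fR by (intro card_mono) auto
  then have "i \<noteq> 0" using i h by (intro notI) auto
  then show ?thesis using i by (simp add: dvd_power)
qed

text \<open>A form of \<^emph>\<open>normalizers grow in p-groups\<close>: the orbit of \<open>D\<close> under \<open>R\<close> has size divisible
  by \<open>p\<close>, and \<open>B\<close> fixes \<open>D\<close>, so it fixes a further point.\<close>

lemma normalizer_grows:
  assumes R: "subgroup R G" "R \<subseteq> P" and B: "subgroup B G" "B \<subseteq> R"
    and DB: "D \<subseteq> B" "\<And>b. b \<in> B \<Longrightarrow> cs b D = D"
    and D1: "D \<subset> D1" "D1 \<subseteq> R" "\<And>r. r \<in> R \<Longrightarrow> cs r D1 = D1"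
  shows "\<exists>g\<in>D1 - D. cs g D = D"
proof (cases "\<forall>r\<in>R. cs r D = D")
  case True
  then show ?thesis using D1 by blast
next
  case False
  then obtain h where h: "h \<in> R" "cs h D \<noteq> D" by blast
  define Y where "Y = (\<lambda>r. cs r D) ` R"
  \<comment> \<open>\<open>F\<close> collects the points of the orbit that \<open>B\<close> moves;
    the aim is a point of \<open>Y - F\<close> other than \<open>D\<close>.\<close>
  define F where "F = {T \<in> Y. \<exists>b\<in>B. cs b T \<noteq> T}"
  have Rc: "R \<subseteq> carrier G" using R subgroup.subset by blast
  have Dc: "D \<subseteq> carrier G" using DB B Rc by blast
  have fY: "finite Y" using R(2) finite_P finite_subset unfolding Y_def by blast
  have Yc: "T \<subseteq> carrier G" if "T \<in> Y" for T
    using that Rc Dc cs_closed unfolding Y_def by blast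
  have BY: "cs b T \<in> Y" if "T \<in> Y" "b \<in> B" for b T
  proof -
    obtain r where r: "r \<in> R" "T = cs r D" using \<open>T \<in> Y\<close> Y_def by blast
    then have "cs b T = cs (b \<otimes> r) D"
      using that Rc Dc B by (simp add: cs_comp subset_iff)
    moreover have "b \<otimes> r \<in> R" using r that B R subgroup.m_closed by (metis subsetD)
    ultimately show ?thesis unfolding Y_def by blast
  qed
  have Bc: "b \<in> carrier G" if "b \<in> B" for b using that B Rc by blast
  define E where "E = {(T, U). T \<in> F \<and> (\<exists>b\<in>B. U = cs b T)}"
  have EF: "cs b T \<in> F" if T: "T \<in> F" and b: "b \<in> B" for b T
  proof -
    have TY: "T \<in> Y" using T F_def by blast
    have bT: "cs (inv b) (cs b T) = T" by (rule cs_cancel(1)[OF Bc[OF b] Yc[OF TY]])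
    have bY: "cs b T \<in> Y" by (rule BY[OF TY b])
    have ib: "inv b \<in> B" by (rule subgroup.m_inv_closed[OF B(1) b])
    show ?thesis
    proof (cases "cs b T = T")
      case True
      then show ?thesis using T by simp
    next
      case False
      then have "cs (inv b) (cs b T) \<noteq> cs b T" unfolding bT by (rule not_sym)
      then show ?thesis using bY ib unfolding F_def by blast
    qed
  qed
  have FY: "F \<subseteq> Y" unfolding F_def by blast
  \<comment> \<open>The classes of \<open>E\<close> are the orbits of \<open>B\<close> on
    \<open>F\<close>. None is a single point, so each has size divisible by \<open>p\<close>, and so
    has \<open>F\<close>.\<close>
  have "equiv F E"
  proof (rule equivI)
    show "E \<subseteq> F \<times> F" using EF unfolding E_def by blast
    show "refl_on F E"
      unfolding refl_on_def
    proof clarify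
      fix T assume "T \<in> F"
      then have "T = cs \<one> T" using FY cs_one[OF Yc] by auto
      then show "(T, T) \<in> E" using \<open>T \<in> F\<close> subgroup.one_closed[OF B(1)] unfolding E_def by blast
    qed
    show "sym E"
    proof (rule symI)
      fix T U assume "(T, U) \<in> E"
      then obtain b where b: "T \<in> F" "b \<in> B" "U = cs b T" unfolding E_def by blast
      then have "U \<in> F" "T = cs (inv b) U" using EF cs_cancel(1)[OF Bc Yc] FY by auto
      then show "(U, T) \<in> E" using subgroup.m_inv_closed[OF B(1) b(2)] unfolding E_def by blast
    qed
    show "trans E"
    proof (rule transI)
      fix T U V assume "(T, U) \<in> E" "(U, V) \<in> E"
      then obtain b c where b: "T \<in> F" "b \<in> B" "U = cs b T" "c \<in> B" "V = cs c U" unfolding E_def by blast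
      then have "V = cs (c \<otimes> b) T" using cs_comp[OF Bc Bc Yc] FY by auto
      then show "(T, V) \<in> E" using b subgroup.m_closed[OF B(1)] unfolding E_def by blast
    qed
  qed
  then have "p dvd card F"
  proof (rule equiv_imp_dvd_card[rotated])
    show "finite F" using fY FY finite_subset by blast
    fix W assume "W \<in> F // E"
    then obtain T where T: "T \<in> F" "W = E `` {T}" by (auto elim: quotientE)
    then have W: "W = (\<lambda>b. cs b T) ` B" unfolding E_def by blast
    obtain b where "b \<in> B" "cs b T \<noteq> T" using T F_def by blast
    then show "p dvd card W"
      unfolding W using T FY Yc B R by (intro p_dvd_card_orbit) auto
  qed
  moreover have "p dvd card Y"
    unfolding Y_def using R Dc h by (rule p_dvd_card_orbit)
  ultimately have "p dvd card (Y - F)"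
    using FY fY by (simp add: card_Diff_subset finite_subset dvd_diff_nat)
  moreover have DY: "D \<in> Y - F"
    using DB subgroup.one_closed[OF R(1)] cs_one[OF Dc] unfolding Y_def F_def by force
  ultimately have "Y - F \<noteq> {D}"
    using prime_p by (intro notI) auto
  then obtain D' where D': "D' \<in> Y" "D' \<notin> F" "D' \<noteq> D" using DY by blast
  then obtain r where r: "r \<in> R" "D' = cs r D" unfolding Y_def by blast
  have rc: "r \<in> carrier G" using r Rc by blast
  have "cs (inv r) D \<noteq> D" using r D' cs_cancel(2)[OF rc Dc] by metis
  moreover have "card (cs (inv r) D) = card D" using rc Dc by (simp add: card_cs)
  ultimately have "\<not> cs (inv r) D \<subseteq> D"
    using Dc fin by (metis card_subset_eq finite_subset)
  \<comment> \<open>Being in \<open>B\<close>, \<open>d\<close> fixes the new point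
    \<open>D'\<close>. Conjugated back by \<open>r\<close> it fixes \<open>D\<close>, and it lies in
    the invariant set \<open>D1\<close> but not in \<open>D\<close>.\<close>
  then obtain d where d: "d \<in> D" "cj (inv r) d \<notin> D" unfolding cs_def by blast
  have dc: "d \<in> carrier G" using d Dc by blast
  have "cj (inv r) d \<in> cs (inv r) D1" unfolding cs_def using d D1(1) by blast
  then have "cj (inv r) d \<in> D1" using D1(3) r subgroup.m_inv_closed[OF R(1)] by metis
  moreover have "cs d D' = D'" using D' d DB unfolding F_def by blast
  then have "cs (inv r) (cs d (cs r D)) = D" using r cs_cancel rc Dc by simp
  then have "cs (cj (inv r) d) D = D"
    using rc dc Dc by (simp add: cj_def cs_comp cs_closed)
  ultimately show ?thesis using d by blast
qed

section \<open>The p-core\<close>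

text \<open>Left multiplication by \<open>a\<close> is injective on the finite set \<open>S\<close>,
  hence onto, so it reaches \<open>\<one>\<close>.\<close>

lemma finite_submonoid_subgroup:
  assumes S: "S \<subseteq> carrier G" "\<one> \<in> S" and closed: "\<And>x y. x \<in> S \<Longrightarrow> y \<in> S \<Longrightarrow> x \<otimes> y \<in> S"
  shows "subgroup S G"
proof (rule subgroupI)
  fix a assume a: "a \<in> S"
  have fS: "finite S" using S fin finite_subset by blast
  have "inj_on (\<lambda>s. a \<otimes> s) S" using a S by (auto intro!: inj_onI simp: subset_iff)
  moreover have "(\<lambda>s. a \<otimes> s) ` S \<subseteq> S" using a closed by blast
  ultimately have "(\<lambda>s. a \<otimes> s) ` S = S" using endo_inj_surj[OF fS] by blast
  then obtain s where s: "s \<in> S" "\<one> = a \<otimes> s" using S(2) by (metis imageE)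
  then have "s = inv a" using a S by (metis inv_equality inv_inv subsetD)
  then show "inv a \<in> S" using s by simp
qed (use S closed in auto)

section \<open>Extending a p-subgroup by a p-element that normalizes it\<close>

lemma cj_pow_closed:
  assumes "K \<subseteq> carrier G" "y \<in> carrier G" "\<And>k. k \<in> K \<Longrightarrow> cj y k \<in> K" "k \<in> K"
  shows "cj (y [^] (n::nat)) k \<in> K"
proof (induction n)
  case 0
  then show ?case using assms by auto
next
  case (Suc n)
  then show ?case using assms(3)[OF Suc] assms
    by (subst nat_pow_Suc2) (auto simp: cj_comp)
qed

text \<open>Moving all factors from \<open>K\<close> to the left turns
  \<open>(x \<otimes> y) [^] n\<close> into \<open>k \<otimes> y [^] n\<close> with \<open>k\<close>
  in \<open>K\<close>. When \<open>n = p ^ m\<close> kills \<open>y\<close>, this power lies in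
  \<open>K\<close>, so \<open>x \<otimes> y\<close> is a root of a p-element.\<close>

lemma mult_normal_P:
  assumes K: "subgroup K G" "K \<subseteq> P" and y: "y \<in> P" "\<And>k. k \<in> K \<Longrightarrow> cj y k \<in> K" and x: "x \<in> K"
  shows "x \<otimes> y \<in> P"
proof -
  obtain m where m: "y \<in> carrier G" "y [^] (p ^ m) = \<one>" using y mem_P_iff by auto
  have Kc: "k \<in> carrier G" if "k \<in> K" for k using that subgroup.subset[OF K(1)] by blast
  have "\<exists>k\<in>K. (x \<otimes> y) [^] n = k \<otimes> y [^] n" for n :: nat
  proof (induction n)
    case 0
    then show ?case using subgroup.one_closed[OF K(1)] by force
  next
    case (Suc n)
    then obtain k where k: "k \<in> K" "(x \<otimes> y) [^] n = k \<otimes> y [^] n" by blast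
    have "cj (y [^] n) x \<in> K"
      using x y m Kc by (intro cj_pow_closed) auto
    then have "k \<otimes> cj (y [^] n) x \<in> K" using subgroup.m_closed[OF K(1) k(1)] by blast
    moreover have "(x \<otimes> y) [^] Suc n = k \<otimes> cj (y [^] n) x \<otimes> y [^] Suc n"
      using k x Kc m by (simp add: cj_def m_assoc)
    ultimately show ?case by blast
  qed
  from this[of "p ^ m"] obtain k where "k \<in> K" "(x \<otimes> y) [^] (p ^ m) = k \<otimes> \<one>"
    using m(2) by metis
  then have "(x \<otimes> y) [^] (p ^ m) \<in> P" using K Kc by auto
  then show ?thesis using x Kc m(1) by (intro P_root[of "x \<otimes> y"]) auto
qed

text \<open>The product of \<open>K\<close> with the cyclic group of \<open>y\<close>; natural
  exponents reach all of that group because \<open>y\<close> has finite order.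
  \<open>ext {\<one>} y\<close> is the cyclic group itself.\<close>

definition ext :: "'a set \<Rightarrow> 'a \<Rightarrow> 'a set" where
  "ext K y = {k \<otimes> y [^] n | k n. k \<in> K \<and> n \<in> (UNIV :: nat set)}"

lemma
  assumes K: "subgroup K G" "K \<subseteq> P" and y: "y \<in> P" "\<And>k. k \<in> K \<Longrightarrow> cj y k \<in> K"
  shows subgroup_ext: "subgroup (ext K y) G" and ext_P: "ext K y \<subseteq> P"
    and base_ext: "K \<subseteq> ext K y" and gen_ext: "y \<in> ext K y"
proof -
  have yc: "y \<in> carrier G" using y P_carrier by blast
  have Kc: "k \<in> carrier G" if "k \<in> K" for k using that subgroup.subset[OF K(1)] by blast
  show KE: "K \<subseteq> ext K y"
  proof
    fix k assume "k \<in> K"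
    then have "k = k \<otimes> y [^] (0::nat)" using Kc by simp
    then show "k \<in> ext K y" unfolding ext_def using \<open>k \<in> K\<close> by blast
  qed
  show "y \<in> ext K y"
  proof -
    have "y = \<one> \<otimes> y [^] (1::nat)" using yc by simp
    then show ?thesis unfolding ext_def using subgroup.one_closed[OF K(1)] by blast
  qed
  show "subgroup (ext K y) G"
  proof (rule finite_submonoid_subgroup)
    show "ext K y \<subseteq> carrier G" unfolding ext_def using yc Kc by auto
    show "\<one> \<in> ext K y" using subgroup.one_closed[OF K(1)] KE by blast
    fix u v assume "u \<in> ext K y" "v \<in> ext K y"
    then obtain k n l m where uv: "u = k \<otimes> y [^] (n::nat)" "v = l \<otimes> y [^] (m::nat)" "k \<in> K" "l \<in> K"
      unfolding ext_def by blast
    have "cj (y [^] n) l \<in> K"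
      using uv y yc Kc by (intro cj_pow_closed) auto
    then have "k \<otimes> cj (y [^] n) l \<in> K" using subgroup.m_closed[OF K(1) uv(3)] by blast
    moreover have "u \<otimes> v = k \<otimes> cj (y [^] n) l \<otimes> y [^] (n + m)"
      using uv Kc yc by (simp add: cj_def m_assoc flip: nat_pow_mult)
    ultimately show "u \<otimes> v \<in> ext K y" unfolding ext_def by blast
  qed
  show "ext K y \<subseteq> P"
  proof
    fix u assume "u \<in> ext K y"
    then obtain k n where u: "u = k \<otimes> y [^] (n::nat)" "k \<in> K" unfolding ext_def by blast
    have "cj (y [^] n) l \<in> K" if "l \<in> K" for l
      using that y yc Kc by (intro cj_pow_closed) auto
    then show "u \<in> P" unfolding u using K P_pow[OF y(1)] u by (intro mult_normal_P) auto
  qed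
qed

text \<open>For a subgroup \<open>H\<close> this is \<open>O\<^sub>p(H)\<close>, the largest normal p-subgroup of \<open>H\<close>, described as the
  stabilizer of the set of p-elements of \<open>H\<close> under left multiplication.\<close>

definition p_core :: "'a set \<Rightarrow> 'a set" where
  "p_core H = {x \<in> H. \<forall>y\<in>H \<inter> P. x \<otimes> y \<in> P}"

lemma p_core_subset: "p_core H \<subseteq> H"
  by (auto simp: p_core_def)

lemma p_core_P: "subgroup H G \<Longrightarrow> p_core H \<subseteq> P"
proof
  fix x assume "subgroup H G" "x \<in> p_core H"
  then have "x \<otimes> \<one> \<in> P" "x \<in> carrier G"
    using one_P subgroup.one_closed subgroup.mem_carrier unfolding p_core_def by fast+
  then show "x \<in> P" by simp
qed

lemma subgroup_p_core:
  assumes H: "subgroup H G"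
  shows "subgroup (p_core H) G"
proof (rule finite_submonoid_subgroup)
  have Hc: "H \<subseteq> carrier G" using H subgroup.subset by blast
  show "p_core H \<subseteq> carrier G" using Hc p_core_subset by blast
  show "\<one> \<in> p_core H" using subgroup.one_closed[OF H] Hc by (auto simp: p_core_def)
  fix x y assume *: "x \<in> p_core H" "y \<in> p_core H"
  have "x \<otimes> y \<otimes> z \<in> P" if z: "z \<in> H" "z \<in> P" for z
  proof -
    have "y \<otimes> z \<in> H \<inter> P" using * z subgroup.m_closed[OF H, of y z] by (auto simp: p_core_def)
    then have "x \<otimes> (y \<otimes> z) \<in> P" using * unfolding p_core_def by blast
    then show ?thesis using * z Hc by (auto simp: p_core_def m_assoc subset_iff)
  qed
  then show "x \<otimes> y \<in> p_core H" using * subgroup.m_closed[OF H, of x y] by (auto simp: p_core_def)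
qed

text \<open>Conjugation by \<open>g\<close> permutes the p-elements of \<open>H\<close>, so the
  condition on \<open>cj g x\<close> at \<open>y\<close> is the condition on \<open>x\<close> at
  \<open>cj (inv g) y\<close>.\<close>

lemma p_core_cj:
  assumes H: "subgroup H G" and g: "g \<in> H" and x: "x \<in> p_core H"
  shows "cj g x \<in> p_core H"
proof -
  have Hc: "h \<in> carrier G" if "h \<in> H" for h using that H subgroup.subset by blast
  have xH: "x \<in> H" using x p_core_subset by blast
  have "cj g x \<otimes> y \<in> P" if y: "y \<in> H" "y \<in> P" for y
  proof -
    have "cj (inv g) y \<in> H \<inter> P"
      using y P_cj[OF y(2), of "inv g"] cj_closed_subgroup[OF H _ y(1), of "inv g"]
        subgroup.m_inv_closed[OF H g] Hc by simp
    then have "x \<otimes> cj (inv g) y \<in> P" using x unfolding p_core_def by blast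
    then have "cj g (x \<otimes> cj (inv g) y) \<in> P" by (rule P_cj[OF _ Hc[OF g]])
    then show ?thesis using g y xH Hc by (simp add: cj_mult)
  qed
  then show ?thesis using cj_closed_subgroup[OF H g xH] unfolding p_core_def by blast
qed

lemma p_core_whole: "subgroup H G \<Longrightarrow> H \<subseteq> P \<Longrightarrow> p_core H = H"
  using subgroup.m_closed[of H G] unfolding p_core_def by auto

lemma invariant_subset_p_core:
  assumes H: "subgroup H G" and K: "subgroup K G" "K \<subseteq> P" and D: "D \<subseteq> K" "D \<subseteq> H"
    and inv: "\<And>h d. h \<in> H \<Longrightarrow> d \<in> D \<Longrightarrow> cj h d \<in> D"
  shows "D \<subseteq> p_core H"
proof -
  define W where "W = generate G D"
  have Hc: "h \<in> carrier G" if "h \<in> H" for h using that H subgroup.subset by blast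
  have Dc: "D \<subseteq> carrier G" using D Hc by blast
  have W: "subgroup W G" unfolding W_def using generate_is_subgroup[OF Dc] .
  have WK: "W \<subseteq> K" unfolding W_def using generate_subgroup_incl[OF D(1) K(1)] .
  have WH: "W \<subseteq> H" unfolding W_def using generate_subgroup_incl[OF D(2) H] .
  have Winv: "cj h w \<in> W" if h: "h \<in> H" and w: "w \<in> W" for h w
    using w unfolding W_def
  proof (induction rule: generate.induct)
    case one
    then show ?case using h Hc generate.one by simp
  next
    case (incl d)
    then show ?case using inv[OF h] generate.incl by metis
  next
    case (inv d)
    then have "cj h (inv d) = inv (cj h d)" using h Hc Dc by (intro cj_inv) auto
    then show ?case using assms(6)[OF h inv] generate.inv by metis
  next
    case (eng u v)
    then have "u \<in> carrier G" "v \<in> carrier G"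
      using generate_in_carrier[OF Dc] by metis+
    then have "cj h (u \<otimes> v) = cj h u \<otimes> cj h v" using h Hc by (intro cj_mult) auto
    then show ?case using generate.eng[OF eng.IH] by simp
  qed
  then have "x \<otimes> y \<in> P" if "x \<in> W" "y \<in> H \<inter> P" for x y
    using mult_normal_P[OF W _ _ _ that(1), of y] that(2) WK K(2) Winv by auto
  then have "W \<subseteq> p_core H" using WH by (auto simp: p_core_def)
  moreover have "D \<subseteq> W" unfolding W_def by (auto intro: generate.incl)
  ultimately show ?thesis by blast
qed

end

section \<open>The zipper argument\<close>

text \<open>The setting of the zipper lemma with membership in the p-core in place of subnormality:
  the class of \<open>z\<close> avoids the core of \<open>H\<close>, but each of its members lies in
  the core of every proper subgroup containing it.\<close>

locale minimal_non_core = finite_group_prime +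
  fixes H :: "'a set" and z :: 'a
  assumes H: "subgroup H G" and zH: "z \<in> H" and zP: "z \<in> P" and z_core: "z \<notin> p_core H"
    and minimal: "\<And>L h. subgroup L G \<Longrightarrow> L \<subset> H \<Longrightarrow> h \<in> H \<Longrightarrow> cj h z \<in> L \<Longrightarrow> cj h z \<in> p_core L"
begin

definition Y where "Y = (\<lambda>h. cj h z) ` H"

lemma Hc: "h \<in> H \<Longrightarrow> h \<in> carrier G"
  using subgroup.subset[OF H] by auto

lemma zY: "z \<in> Y"
  using subgroup.one_closed[OF H] Hc[OF zH] unfolding Y_def by force

lemma YH: "Y \<subseteq> H"
  using cj_closed_subgroup[OF H _ zH] unfolding Y_def by auto

lemma YP: "Y \<subseteq> P"
  using P_cj[OF zP Hc] unfolding Y_def by auto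

lemma Yc: "Y \<subseteq> carrier G"
  using YP P_carrier by auto

lemma cj_Y: "h \<in> H \<Longrightarrow> y \<in> Y \<Longrightarrow> cj h y \<in> Y"
  using zH by (auto simp: Y_def Hc subgroup.m_closed[OF H] simp flip: cj_comp)

section \<open>Traces of proper subgroups on the class of \<open>z\<close>\<close>

definition N where "N D = {h \<in> H. cs h D = D}"

lemma subgroup_N:
  assumes D: "D \<subseteq> Y"
  shows "subgroup (N D) G"
proof (rule finite_submonoid_subgroup)
  have Dc: "D \<subseteq> carrier G" using D Yc by auto
  show "N D \<subseteq> carrier G" unfolding N_def using Hc by auto
  show "\<one> \<in> N D" unfolding N_def using subgroup.one_closed[OF H] cs_one[OF Dc] by simp
  show "x \<otimes> y \<in> N D" if "x \<in> N D" "y \<in> N D" for x y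
    using that Dc Hc by (auto simp: N_def cs_comp subgroup.m_closed[OF H])
qed

text \<open>If \<open>H\<close> normalized \<open>D\<close>, then \<open>D\<close> would lie in the
  core of \<open>H\<close>; but \<open>D\<close> contains a conjugate of \<open>z\<close>.\<close>

lemma N_psubset:
  assumes D: "D \<subseteq> Y" "D \<noteq> {}" and K: "subgroup K G" "K \<subseteq> P" "D \<subseteq> K"
  shows "N D \<subset> H"
proof -
  have "N D \<noteq> H"
  proof
    assume ND: "N D = H"
    have "cj h d \<in> D" if "h \<in> H" "d \<in> D" for h d
      using that ND unfolding N_def cs_def by blast
    then have core: "D \<subseteq> p_core H"
      using invariant_subset_p_core[OF H K(1,2)] K D YH by auto
    obtain h where h: "h \<in> H" "cj h z \<in> D" using D unfolding Y_def by auto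
    then have "cj (inv h) (cj h z) \<in> p_core H"
      using core by (intro p_core_cj[OF H subgroup.m_inv_closed[OF H h(1)]]) (rule subsetD)
    then show False using z_core h Hc zH by simp
  qed
  then show ?thesis unfolding N_def by auto
qed

definition Fam where "Fam = {Y \<inter> L | L. subgroup L G \<and> L \<subset> H}"

text \<open>These maximal traces are the blocks; they turn out to partition
  \<open>Y\<close>.\<close>

definition maximal where "maximal D \<longleftrightarrow> D \<in> Fam \<and> (\<forall>D'\<in>Fam. D \<subseteq> D' \<longrightarrow> D = D')"

lemma FamI: "subgroup L G \<Longrightarrow> L \<subset> H \<Longrightarrow> Y \<inter> L \<in> Fam"
  unfolding Fam_def by auto

lemma FamE:
  assumes "D \<in> Fam"
  obtains L where "subgroup L G" "L \<subset> H" "D = Y \<inter> L" "D \<subseteq> p_core L"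
proof -
  obtain L where L: "subgroup L G" "L \<subset> H" "D = Y \<inter> L" using assms unfolding Fam_def by auto
  then have "D \<subseteq> p_core L" using minimal[OF L(1,2)] unfolding Y_def by auto
  then show ?thesis using L that by simp
qed

lemma Fam_Y: "D \<in> Fam \<Longrightarrow> D \<subseteq> Y"
  unfolding Fam_def by auto

lemma finite_Y: "finite Y"
  using YP finite_P finite_subset by auto

lemma finite_Fam: "finite Fam"
  using Fam_Y finite_Y by (intro finite_subset[of Fam "Pow Y"]) auto

lemma ex_maximal: "D \<in> Fam \<Longrightarrow> \<exists>M. maximal M \<and> D \<subseteq> M"
  using finite_has_maximal2[OF finite_Fam] unfolding maximal_def by metis

lemma N_psubset_Fam:
  assumes D: "D \<in> Fam" "D \<noteq> {}"
  shows "N D \<subset> H"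
proof -
  obtain L where L: "subgroup L G" "D \<subseteq> p_core L" using FamE[OF D(1)] by metis
  show ?thesis
    using N_psubset[OF Fam_Y[OF D(1)] D(2) subgroup_p_core[OF L(1)] p_core_P[OF L(1)] L(2)] .
qed

lemma cs_Y_subgroup:
  assumes L: "subgroup L G" and g: "g \<in> L" "g \<in> H"
  shows "cs g (Y \<inter> L) = Y \<inter> L"
  using Hc[OF g(2)] Yc cj_Y[OF g(2)] cj_closed_subgroup[OF L g(1)] by (intro cs_eqI) auto

lemma Fam_subset_N:
  assumes D: "D \<in> Fam"
  shows "D \<subseteq> N D"
proof -
  obtain L where L: "subgroup L G" "D = Y \<inter> L" using FamE[OF D] by metis
  show ?thesis unfolding N_def using cs_Y_subgroup[OF L(1)] L(2) YH by auto
qed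

text \<open>By minimality \<open>Y \<inter> L1\<close> lies in the p-group \<open>p_core L1\<close>,
  which also normalizes it. So \<open>normalizer_grows\<close> applies, with the part of this
  p-group inside \<open>L2\<close> as \<open>B\<close>.\<close>

lemma Fam_grows:
  assumes L1: "subgroup L1 G" "L1 \<subset> H" and L2: "subgroup L2 G" "L2 \<subset> H"
    and "\<not> Y \<inter> L1 \<subseteq> L2"
  shows "\<exists>g\<in>Y \<inter> L1 - Y \<inter> L1 \<inter> L2. cs g (Y \<inter> L1 \<inter> L2) = Y \<inter> L1 \<inter> L2"
proof (rule normalizer_grows)
  show "subgroup (p_core L1) G" "p_core L1 \<subseteq> P"
    using subgroup_p_core p_core_P L1 by auto
  show "subgroup (L2 \<inter> p_core L1) G"
    using L2 subgroup_p_core[OF L1(1)] subgroups_Inter_pair by auto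
  show core: "Y \<inter> L1 \<subseteq> p_core L1"
    using minimal[OF L1] unfolding Y_def by auto
  then show "Y \<inter> L1 \<inter> L2 \<subseteq> L2 \<inter> p_core L1" by auto
  show "L2 \<inter> p_core L1 \<subseteq> p_core L1" by auto
  show "Y \<inter> L1 \<inter> L2 \<subset> Y \<inter> L1" using assms(5) by auto
  show "cs r (Y \<inter> L1) = Y \<inter> L1" if "r \<in> p_core L1" for r
    using that p_core_subset L1 by (intro cs_Y_subgroup) auto
  have "subgroup (L1 \<inter> L2) G" using L1 L2 subgroups_Inter_pair by auto
  then show "cs b (Y \<inter> L1 \<inter> L2) = Y \<inter> L1 \<inter> L2" if "b \<in> L2 \<inter> p_core L1" for b
    unfolding Int_assoc using that p_core_subset L1 by (intro cs_Y_subgroup) auto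
qed

text \<open>The zipper, by induction from large intersections to small ones. The normalizer of
  \<open>D = D1 \<inter> D2\<close> meets both blocks in more than \<open>D\<close>. Being proper in
  \<open>H\<close>, it has its trace in some block \<open>M\<close>, and the larger intersections
  with \<open>M\<close> force \<open>D1 = M = D2\<close>.\<close>

lemma maximal_disjoint:
  "maximal D1 \<Longrightarrow> maximal D2 \<Longrightarrow> D1 \<inter> D2 \<noteq> {} \<Longrightarrow> D1 = D2"
proof (induction "card Y - card (D1 \<inter> D2)" arbitrary: D1 D2 rule: less_induct)
  case less
  show ?case
  proof (rule ccontr)
    assume ne: "D1 \<noteq> D2"
    have F: "D1 \<in> Fam" "D2 \<in> Fam" using less.prems unfolding maximal_def by auto
    obtain L1 where L1: "subgroup L1 G" "L1 \<subset> H" "D1 = Y \<inter> L1" using FamE[OF F(1)] by metis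
    obtain L2 where L2: "subgroup L2 G" "L2 \<subset> H" "D2 = Y \<inter> L2" using FamE[OF F(2)] by metis
    define D where "D = D1 \<inter> D2"
    have D: "D = Y \<inter> L1 \<inter> L2" "D = Y \<inter> L2 \<inter> L1" unfolding D_def L1 L2 by auto
    have nsub: "\<not> D1 \<subseteq> D2" "\<not> D2 \<subseteq> D1"
      using less.prems F ne unfolding maximal_def by auto
    obtain g1 where g1: "g1 \<in> D1 - D" "cs g1 D = D"
      using Fam_grows[OF L1(1,2) L2(1,2)] nsub L1(3) L2(3) D(1) by auto
    obtain g2 where g2: "g2 \<in> D2 - D" "cs g2 D = D"
      using Fam_grows[OF L2(1,2) L1(1,2)] nsub L1(3) L2(3) D(2) by auto
    have "subgroup (L1 \<inter> L2) G" using L1 L2 subgroups_Inter_pair by auto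
    then have DF: "D \<in> Fam" using L1(2) FamI[of "L1 \<inter> L2"] D(1) by (auto simp: Int_assoc)
    have D0: "D \<noteq> {}" using less.prems D_def by simp
    obtain M where M: "maximal M" "Y \<inter> N D \<subseteq> M"
      using ex_maximal[OF FamI[OF subgroup_N[OF Fam_Y[OF DF]] N_psubset_Fam[OF DF D0]]] by auto
    have DM: "D \<subseteq> M" using Fam_subset_N[OF DF] Fam_Y[OF DF] M(2) by auto
    have "D' = M" if D': "maximal D'" "D \<subseteq> D'" and g: "g \<in> D' - D" "cs g D = D" for D' g
    proof (rule less.hyps)
      have D'Y: "D' \<subseteq> Y" using D' Fam_Y unfolding maximal_def by auto
      then have "g \<in> M" using g M YH unfolding N_def by auto
      then have "D \<subset> D' \<inter> M" using D' DM g by auto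
      then have "card D < card (D' \<inter> M)" "card (D' \<inter> M) \<le> card Y"
        using D'Y finite_Y by (auto intro!: psubset_card_mono card_mono intro: finite_subset)
      then show "card Y - card (D' \<inter> M) < card Y - card (D1 \<inter> D2)" unfolding D_def by linarith
      show "D' \<inter> M \<noteq> {}" using D' DM D0 by auto
    qed (use D' M in auto)
    from this[OF less.prems(1) _ g1] this[OF less.prems(2) _ g2]
    have "D1 = M" "D2 = M" unfolding D_def by auto
    then show False using ne by simp
  qed
qed

section \<open>Conjugation of blocks by elements of \<open>H\<close>\<close>

lemma cs_subgroup:
  assumes L: "subgroup L G" and h: "h \<in> carrier G"
  shows "subgroup (cs h L) G"
proof (rule finite_submonoid_subgroup)
  have Lc: "l \<in> carrier G" if "l \<in> L" for l using that subgroup.subset[OF L] by auto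
  show "cs h L \<subseteq> carrier G" unfolding cs_def using Lc h by auto
  show "\<one> \<in> cs h L" unfolding cs_def using subgroup.one_closed[OF L] h by force
  fix x y assume "x \<in> cs h L" "y \<in> cs h L"
  then obtain k l where "k \<in> L" "x = cj h k" "l \<in> L" "y = cj h l" unfolding cs_def by auto
  then have "x \<otimes> y = cj h (k \<otimes> l)" "k \<otimes> l \<in> L"
    using Lc h subgroup.m_closed[OF L] by (auto simp: cj_mult)
  then show "x \<otimes> y \<in> cs h L" unfolding cs_def by auto
qed

lemma cs_Fam:
  assumes D: "D \<in> Fam" and h: "h \<in> H"
  shows "cs h D \<in> Fam"
proof -
  obtain L where L: "subgroup L G" "L \<subset> H" "D = Y \<inter> L" using FamE[OF D] by metis
  have Lc: "L \<subseteq> carrier G" using subgroup.subset[OF L(1)] .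
  have "cs h L \<subseteq> H" unfolding cs_def using cj_closed_subgroup[OF H h] L(2) by auto
  moreover have "card (cs h L) < card H"
    using card_cs[OF Hc[OF h] Lc] L(2) finite_subset[OF subgroup.subset[OF H] fin]
    by (simp add: psubset_card_mono)
  ultimately have "cs h L \<subset> H" by auto
  moreover have "cs h D = Y \<inter> cs h L"
  proof
    show "cs h D \<subseteq> Y \<inter> cs h L" unfolding cs_def L(3) using cj_Y[OF h] by auto
    show "Y \<inter> cs h L \<subseteq> cs h D"
    proof
      fix y assume y: "y \<in> Y \<inter> cs h L"
      then obtain l where l: "l \<in> L" "y = cj h l" unfolding cs_def by auto
      then have "l = cj (inv h) y" using h Hc Lc by auto
      then have "l \<in> Y" using y cj_Y subgroup.m_inv_closed[OF H h] by auto
      then show "y \<in> cs h D" unfolding cs_def L(3) using l by auto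
    qed
  qed
  ultimately show ?thesis using FamI[OF cs_subgroup[OF L(1) Hc[OF h]]] by simp
qed

text \<open>\<open>cs h D\<close> lies in some block; this block meets \<open>D\<close>, so it is
  \<open>D\<close>, and equal sizes finish the argument.\<close>

lemma maximal_cs_eq:
  assumes D: "maximal D" and h: "h \<in> H" and "D \<inter> cs h D \<noteq> {}"
  shows "cs h D = D"
proof -
  have DF: "D \<in> Fam" using D unfolding maximal_def by simp
  have Dc: "D \<subseteq> carrier G" using Fam_Y[OF DF] Yc by simp
  obtain M where M: "maximal M" "cs h D \<subseteq> M" using ex_maximal[OF cs_Fam[OF DF h]] by auto
  have "M = D" using maximal_disjoint[OF M(1) D] assms(3) M(2) by auto
  then show ?thesis
    using M(2) card_cs[OF Hc[OF h] Dc] Dc fin finite_subset by (intro card_subset_eq) auto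
qed

text \<open>The cyclic group of \<open>y\<close> is proper in \<open>H\<close>: otherwise
  \<open>H\<close> would be a p-group, equal to its own core, which does not contain
  \<open>z\<close>.\<close>

lemma ex_maximal_mem:
  assumes y: "y \<in> Y"
  shows "\<exists>D. maximal D \<and> y \<in> D"
proof -
  have one: "subgroup {\<one>} G" using triv_subgroup .
  have yP: "y \<in> P" "y \<in> carrier G" using y YP Yc by auto
  have E: "subgroup (ext {\<one>} y) G" "ext {\<one>} y \<subseteq> P" "y \<in> ext {\<one>} y"
    using yP one one_P by (auto intro!: subgroup_ext gen_ext dest!: ext_P[THEN subsetD, rotated -1])
  have "ext {\<one>} y \<subseteq> H"
    using y YH pow_closed_subgroup[OF H] Hc by (auto simp: ext_def)
  moreover have "ext {\<one>} y \<noteq> H"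
    using E z_core zH p_core_whole[OF H] by auto
  ultimately have "Y \<inter> ext {\<one>} y \<in> Fam" using FamI E by auto
  then show ?thesis using ex_maximal y E(3) by blast
qed

text \<open>\<open>z\<close> fixes only its own block among the maximal members of \<open>Fam\<close>; one block together with the
  \<open>p\<close> translates of another under powers of \<open>z\<close> gives \<open>p + 1\<close> blocks.\<close>

lemma pairwise_generating_conjugates:
  "\<exists>A\<subseteq>Y. card A = p + 1 \<and>
     (\<forall>a\<in>A. \<forall>b\<in>A. a \<noteq> b \<longrightarrow> (\<forall>L. subgroup L G \<longrightarrow> a \<in> L \<longrightarrow> b \<in> L \<longrightarrow> H \<subseteq> L))"
proof -
  \<comment> \<open>Two elements are related if they share a block; by \<open>togI\<close> a proper
    subgroup of \<open>H\<close> containing both is enough.\<close>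
  define tog where "tog a b \<longleftrightarrow> (\<exists>D. maximal D \<and> a \<in> D \<and> b \<in> D)" for a b
  have tog_sym: "tog a b \<longleftrightarrow> tog b a" for a b unfolding tog_def by auto
  have tog_refl: "tog a a" if "a \<in> Y" for a unfolding tog_def using ex_maximal_mem[OF that] by simp
  have togI: "tog a b" if "D \<in> Fam" "a \<in> D" "b \<in> D" for a b D
    using that ex_maximal unfolding tog_def by blast
  obtain M0 where M0: "maximal M0" "z \<in> M0" using ex_maximal_mem[OF zY] by auto
  have "M0 \<in> Fam" using M0 unfolding maximal_def by simp
  then obtain L0 where L0: "subgroup L0 G" "L0 \<subset> H" "M0 = Y \<inter> L0" "M0 \<subseteq> p_core L0" by (rule FamE)
  \<comment> \<open>A single block would be an \<open>H\<close>-invariant subset of the p-group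
    \<open>p_core L0\<close>, which puts \<open>z\<close> into the core of \<open>H\<close>.\<close>
  have "\<not> Y \<subseteq> M0"
  proof
    assume "Y \<subseteq> M0"
    then have "Y \<subseteq> p_core H"
      using L0 cj_Y YH p_core_P[OF L0(1)] subgroup_p_core[OF L0(1)]
      by (intro invariant_subset_p_core[OF H, of "p_core L0"]) auto
    then show False using zY z_core by auto
  qed
  then obtain b where b: "b \<in> Y" "b \<notin> M0" by auto
  define c where "c i = cj (z [^] i) b" for i :: nat
  have zi: "z [^] i \<in> H" for i :: nat using pow_closed_subgroup[OF H zH] .
  have cY: "c i \<in> Y" for i unfolding c_def using cj_Y[OF zi b(1)] .
  have bc: "b \<in> carrier G" "z \<in> carrier G" using b Yc Hc zH by auto
  \<comment> \<open>Powers of \<open>z\<close> lie in \<open>L0\<close>, so a \<open>c i\<close> in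
    \<open>M0\<close> could be conjugated back to put \<open>b\<close> into
    \<open>M0\<close>.\<close>
  have zc: "\<not> tog z (c i)" for i
  proof
    assume "tog z (c i)"
    then obtain D where D: "maximal D" "z \<in> D" "c i \<in> D" unfolding tog_def by auto
    then have "D = M0" using maximal_disjoint M0 by blast
    then have "c i \<in> L0" "z [^] i \<in> L0"
      using D(3) L0(3) M0(2) pow_closed_subgroup[OF L0(1)] by auto
    then have "cj (inv (z [^] i)) (c i) \<in> L0"
      using cj_closed_subgroup[OF L0(1)] subgroup.m_inv_closed[OF L0(1)] by auto
    then show False using b L0(3) bc unfolding c_def by simp
  qed
  \<comment> \<open>The power \<open>z [^] (j - i)\<close> carries \<open>D\<close> to a set meeting
    \<open>D\<close>, so it normalizes \<open>D\<close>; by coprimality so does \<open>z\<close>.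
    Then the proper subgroup \<open>N D\<close> contains both \<open>z\<close> and
    \<open>c i\<close>, against \<open>zc\<close>.\<close>
  have cc: "\<not> tog (c i) (c j)" if ij: "i < j" "j < p" for i j
  proof
    assume "tog (c i) (c j)"
    then obtain D where D: "maximal D" "c i \<in> D" "c j \<in> D" unfolding tog_def by auto
    have DF: "D \<in> Fam" using D unfolding maximal_def by simp
    have "c j = cj (z [^] (j - i)) (c i)"
      unfolding c_def using bc ij by (simp add: nat_pow_mult flip: cj_comp)
    then have "c j \<in> cs (z [^] (j - i)) D" unfolding cs_def using D by auto
    then have "cs (z [^] (j - i)) D = D" using maximal_cs_eq[OF D(1) zi] D(3) by auto
    then have "z [^] (j - i) \<in> N D" unfolding N_def using zi by simp
    moreover have "coprime (j - i) p"
      using ij prime_p nat_dvd_not_less[of "j - i" p]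
      by (subst coprime_commute, intro prime_imp_coprime_nat) auto
    ultimately have "z \<in> N D"
      using coprime_pow_mem[OF subgroup_N[OF Fam_Y[OF DF]] zP] by simp
    moreover have "c i \<in> N D" using D(2) Fam_subset_N[OF DF] by auto
    moreover have "Y \<inter> N D \<in> Fam"
      using FamI[OF subgroup_N[OF Fam_Y[OF DF]] N_psubset_Fam[OF DF]] D(2) by auto
    ultimately have "tog z (c i)" using togI zY cY by auto
    then show False using zc by simp
  qed
  have cc': "\<not> tog (c i) (c j)" if "i \<noteq> j" "i < p" "j < p" for i j
    using cc[of i j] cc[of j i] that tog_sym by (metis nat_neq_iff)
  define A where "A = insert z (c ` {..<p})"
  have "inj_on c {..<p}" using cc' tog_refl cY by (intro inj_onI) (metis lessThan_iff)
  moreover have "z \<notin> c ` {..<p}" using zc tog_refl[OF zY] by auto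
  ultimately have "card A = p + 1" unfolding A_def by (simp add: card_image)
  moreover have "A \<subseteq> Y" unfolding A_def using cY zY by auto
  moreover have "H \<subseteq> L" if "a \<in> A" "a' \<in> A" "a \<noteq> a'" "subgroup L G" "a \<in> L" "a' \<in> L" for a a' L
  proof (rule ccontr)
    assume "\<not> H \<subseteq> L"
    then have "L \<inter> H \<subset> H" by auto
    moreover have "subgroup (L \<inter> H) G" using that H subgroups_Inter_pair by auto
    ultimately have "Y \<inter> (L \<inter> H) \<in> Fam" using FamI by auto
    then have "tog a a'" using that \<open>A \<subseteq> Y\<close> YH togI[of "Y \<inter> (L \<inter> H)" a a'] by auto
    then show False using that(1-3) zc tog_sym unfolding A_def by auto (metis cc')
  qed
  ultimately show ?thesis by blast
qed

end

section \<open>Counting commuting p-elements\<close>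

text \<open>Outside the kernel the petals are disjoint, so the union has at least
  \<open>card K + (n + 1) * (s - card K)\<close> elements. The smallness of the kernel makes this at
  least \<open>n * s\<close>.\<close>

lemma sunflower_card:
  fixes S :: "'i \<Rightarrow> 'b set"
  assumes A: "card A = n + 1" and T: "finite T" "\<And>a. a \<in> A \<Longrightarrow> S a \<subseteq> T"
    and K: "\<And>a. a \<in> A \<Longrightarrow> K \<subseteq> S a" "\<And>a b. a \<in> A \<Longrightarrow> b \<in> A \<Longrightarrow> a \<noteq> b \<Longrightarrow> S a \<inter> S b \<subseteq> K"
    and s: "\<And>a. a \<in> A \<Longrightarrow> s \<le> card (S a)" "n * card K \<le> s"
  shows "n * s \<le> card T"
proof (cases "s \<le> card K")
  case True
  obtain a where a: "a \<in> A" using A by fastforce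
  have "card K \<le> card T" using K(1)[OF a] T(2)[OF a] T(1) by (meson card_mono order_trans)
  moreover have "n * s \<le> card K" using s(2) True by (meson le_trans mult_le_mono2)
  ultimately show ?thesis by simp
next
  case False
  then obtain d where d: "s = card K + d" by (metis le_Suc_ex linear)
  have fA: "finite A" using A card.infinite by fastforce
  have fS: "finite (S a)" if "a \<in> A" for a using T that finite_subset by blast
  obtain a where a: "a \<in> A" using A by fastforce
  have fK: "finite K" using K(1)[OF a] fS[OF a] finite_subset by blast
  have "d \<le> card (S a - K)" if "a \<in> A" for a
    using s(1)[OF that] d card_Diff_subset[OF fK K(1)[OF that]] by simp
  then have "(n + 1) * d \<le> (\<Sum>a\<in>A. card (S a - K))"
    using sum_bounded_below[of A d "\<lambda>a. card (S a - K)"] A by simp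
  also have "\<dots> = card (\<Union>a\<in>A. S a - K)"
    using fA fS K(2) by (subst card_UN_disjoint) auto
  finally have "card K + (n + 1) * d \<le> card K + card (\<Union>a\<in>A. S a - K)" by simp
  also have "\<dots> = card (K \<union> (\<Union>a\<in>A. S a - K))"
    using fK fA fS by (subst card_Un_disjoint) auto
  also have "\<dots> \<le> card T"
    using T K(1)[OF a] a by (intro card_mono) auto
  finally show ?thesis using s(2) d by (simp add: algebra_simps)
qed

context finite_group_prime
begin

text \<open>A subgroup of least order among those containing a conjugate of \<open>x\<close> outside
  their core satisfies \<open>minimal_non_core\<close>; \<open>carrier G\<close> is a candidate,
  with the conjugation by \<open>\<one>\<close>.\<close>

lemma ex_pairwise_generating_conjugates:
  assumes x: "x \<in> P" "x \<notin> p_core (carrier G)"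
  shows "\<exists>H A. subgroup H G \<and> card A = p + 1 \<and> A \<subseteq> H - p_core H \<and>
    (\<forall>a\<in>A. \<exists>g\<in>carrier G. a = cj g x) \<and>
    (\<forall>a\<in>A. \<forall>b\<in>A. a \<noteq> b \<longrightarrow> (\<forall>L. subgroup L G \<longrightarrow> a \<in> L \<longrightarrow> b \<in> L \<longrightarrow> H \<subseteq> L))"
proof -
  define Q where "Q H \<longleftrightarrow> subgroup H G \<and> (\<exists>g\<in>carrier G. cj g x \<in> H \<and> cj g x \<notin> p_core H)" for H
  have xc: "x \<in> carrier G" using x P_carrier by auto
  have "Q (carrier G)" unfolding Q_def using x xc subgroup_self by (auto intro!: bexI[of _ \<one>])
  then obtain H where H: "Q H" "\<And>L. Q L \<Longrightarrow> card H \<le> card L"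
    using ex_has_least_nat[of Q "carrier G" card] by auto
  then obtain g where g: "g \<in> carrier G" "cj g x \<in> H" "cj g x \<notin> p_core H" unfolding Q_def by auto
  have HG: "subgroup H G" using H unfolding Q_def by auto
  have Hc: "H \<subseteq> carrier G" using subgroup.subset[OF HG] .
  interpret M: minimal_non_core G p H "cj g x"
  proof (intro minimal_non_core.intro minimal_non_core_axioms.intro)
    show "finite_group_prime G p" by unfold_locales
    show "subgroup H G" by (rule HG)
    show "cj g x \<in> P" using P_cj[OF x(1) g(1)] .
    fix L h assume L: "subgroup L G" "L \<subset> H" "h \<in> H" "cj h (cj g x) \<in> L"
    have "card L < card H"
      using L(2) Hc fin finite_subset by (intro psubset_card_mono) auto
    then have "\<not> Q L" using H(2)[of L] by auto
    moreover have "cj h (cj g x) = cj (h \<otimes> g) x" "h \<otimes> g \<in> carrier G"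
      using L(3) g Hc xc by (auto simp: cj_comp)
    ultimately show "cj h (cj g x) \<in> p_core L" using L unfolding Q_def by metis
  qed (use g in auto)
  obtain A where A: "A \<subseteq> M.Y" "card A = p + 1"
    "\<forall>a\<in>A. \<forall>b\<in>A. a \<noteq> b \<longrightarrow> (\<forall>L. subgroup L G \<longrightarrow> a \<in> L \<longrightarrow> b \<in> L \<longrightarrow> H \<subseteq> L)"
    using M.pairwise_generating_conjugates by blast
  have "a \<notin> p_core H \<and> (\<exists>g\<in>carrier G. a = cj g x)" if aY: "a \<in> M.Y" for a
  proof
    obtain h where h: "h \<in> H" "a = cj h (cj g x)" using aY unfolding M.Y_def by auto
    have hc: "h \<in> carrier G" using h Hc by auto
    show "\<exists>g\<in>carrier G. a = cj g x"
      using h hc g xc by (intro bexI[of _ "h \<otimes> g"]) (auto simp: cj_comp)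
    show "a \<notin> p_core H"
    proof
      assume "a \<in> p_core H"
      then have "cj (inv h) a \<in> p_core H"
        using p_core_cj[OF HG subgroup.m_inv_closed[OF HG h(1)]] by simp
      then show False using h hc g xc by simp
    qed
  qed
  then have "A \<subseteq> H - p_core H" "\<forall>a\<in>A. \<exists>g\<in>carrier G. a = cj g x" using A(1) M.YH by auto
  then show ?thesis using HG A(2,3) by blast
qed

section \<open>Centralizers of p-elements\<close>

definition centr :: "'a \<Rightarrow> 'a set" where
  "centr x = {y \<in> carrier G. x \<otimes> y = y \<otimes> x}"

lemma subgroup_centr:
  assumes x: "x \<in> carrier G"
  shows "subgroup (centr x) G"
proof (rule finite_submonoid_subgroup)
  fix y z assume yz: "y \<in> centr x" "z \<in> centr x"
  then have c: "y \<in> carrier G" "z \<in> carrier G" "x \<otimes> y = y \<otimes> x" "x \<otimes> z = z \<otimes> x"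
    by (auto simp: centr_def)
  have "x \<otimes> (y \<otimes> z) = (x \<otimes> y) \<otimes> z" using c(1,2) x by (simp add: m_assoc)
  also have "\<dots> = y \<otimes> (x \<otimes> z)" unfolding c(3) using c(1,2) x by (simp add: m_assoc)
  also have "\<dots> = y \<otimes> z \<otimes> x" unfolding c(4) using c(1,2) x by (simp add: m_assoc)
  finally show "y \<otimes> z \<in> centr x" using c by (simp add: centr_def)
qed (use x in \<open>auto simp: centr_def\<close>)

lemma centr_sym: "x \<in> carrier G \<Longrightarrow> y \<in> centr x \<Longrightarrow> x \<in> centr y"
  by (auto simp: centr_def)

lemma commuting_P_mult:
  assumes "x \<in> P" "y \<in> P" "y \<in> centr x"
  shows "x \<otimes> y \<in> P"
proof -
  have c: "x \<in> carrier G" "y \<in> carrier G" using assms P_carrier by auto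
  obtain m n where mn: "x [^] (p ^ m) = \<one>" "y [^] (p ^ n) = \<one>" using assms mem_P_iff by auto
  have "(x \<otimes> y) [^] (p ^ (m + n)) = x [^] (p ^ (m + n)) \<otimes> y [^] (p ^ (m + n))"
    using assms c by (intro pow_mult_distrib) (auto simp: centr_def)
  also have "x [^] (p ^ (m + n)) = (x [^] (p ^ m)) [^] (p ^ n)"
    using c by (simp add: nat_pow_pow power_add)
  also have "y [^] (p ^ (m + n)) = (y [^] (p ^ n)) [^] (p ^ m)"
    using c by (simp add: nat_pow_pow power_add mult.commute)
  finally have "(x \<otimes> y) [^] (p ^ (m + n)) = \<one>" using mn by simp
  then show ?thesis using c mem_P_iff by blast
qed

lemma card_centr_cj:
  assumes x: "x \<in> carrier G" and g: "g \<in> carrier G"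
  shows "card (centr x \<inter> P) \<le> card (centr (cj g x) \<inter> P)"
proof (rule card_inj_on_le)
  show "inj_on (cj g) (centr x \<inter> P)"
    using cj_inj[OF g] P_carrier by (auto intro: inj_on_subset)
  show "cj g ` (centr x \<inter> P) \<subseteq> centr (cj g x) \<inter> P"
    using x g P_cj by (auto simp: centr_def simp flip: cj_mult)
  show "finite (centr (cj g x) \<inter> P)" using finite_P by simp
qed

text \<open>The sets of p-elements commuting with the \<open>p + 1\<close> conjugates of \<open>x\<close> form a sunflower whose
  kernel \<open>K\<close> is small: its \<open>p\<close> translates by powers of one conjugate lie in the same petal.\<close>

lemma card_centr_noncore:
  assumes x: "x \<in> P" "x \<notin> p_core (carrier G)"
  shows "p * card (centr x \<inter> P) \<le> card P"
proof -
  obtain H A where H: "subgroup H G" and A: "card A = p + 1" "A \<subseteq> H - p_core H"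
    and cjs: "\<And>a. a \<in> A \<Longrightarrow> \<exists>g\<in>carrier G. a = cj g x"
    and gen: "\<And>a b L. a \<in> A \<Longrightarrow> b \<in> A \<Longrightarrow> a \<noteq> b \<Longrightarrow> subgroup L G \<Longrightarrow> a \<in> L \<Longrightarrow> b \<in> L \<Longrightarrow> H \<subseteq> L"
    using ex_pairwise_generating_conjugates[OF x] by metis
  have xc: "x \<in> carrier G" using x P_carrier by auto
  have AP: "a \<in> P" if "a \<in> A" for a using cjs[OF that] P_cj[OF x(1)] by auto
  have Ac: "a \<in> carrier G" if "a \<in> A" for a using AP[OF that] P_carrier by auto
  have Hc: "h \<in> carrier G" if "h \<in> H" for h using subgroup.subset[OF H] that by auto
  \<comment> \<open>The p-elements of the centralizer of \<open>H\<close>; they form the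
    kernel.\<close>
  define K where "K = {k \<in> P. H \<subseteq> centr k}"
  \<comment> \<open>If \<open>a\<close> and \<open>k\<close> commuted, the centralizer of
    \<open>k\<close> would contain both and hence \<open>H\<close>. Then \<open>k\<close> would be a
    central p-element of \<open>H\<close>, so it would lie in the core.\<close>
  have aK: "a \<notin> centr k" if k: "k \<in> A" "a \<in> A" "a \<noteq> k" for a k
  proof
    assume ac: "a \<in> centr k"
    have "H \<subseteq> centr k"
      using gen[OF k(1) k(2)] k ac subgroup_centr[OF Ac[OF k(1)]] Ac[OF k(1)] by (auto simp: centr_def)
    then have "cj h k = k" if "h \<in> H" for h
      using that Ac[OF k(1)] by (intro cj_commute) (auto simp: centr_def)
    moreover have "subgroup (ext {\<one>} k) G" "ext {\<one>} k \<subseteq> P" "k \<in> ext {\<one>} k"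
      using AP[OF k(1)] Ac[OF k(1)] one_P triv_subgroup
      by (auto intro!: subgroup_ext gen_ext dest!: ext_P[THEN subsetD, rotated -1])
    ultimately have "{k} \<subseteq> p_core H"
      using A(2) k(1) by (intro invariant_subset_p_core[OF H, of "ext {\<one>} k"]) auto
    then show False using A(2) k(1) by auto
  qed
  show ?thesis
  proof (rule sunflower_card[where A = A and S = "\<lambda>a. centr a \<inter> P" and K = K])
    show "card A = p + 1" by (rule A(1))
    show "finite P" by (rule finite_P)
    show "K \<subseteq> centr a \<inter> P" if "a \<in> A" for a
      using that A(2) Hc P_carrier unfolding K_def by (auto simp: centr_def)
    show "(centr a \<inter> P) \<inter> (centr b \<inter> P) \<subseteq> K" if ab: "a \<in> A" "b \<in> A" "a \<noteq> b" for a b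
    proof
      fix k assume k: "k \<in> (centr a \<inter> P) \<inter> (centr b \<inter> P)"
      then have "k \<in> carrier G" using P_carrier by auto
      then have "H \<subseteq> centr k"
        using k ab Ac by (intro gen[OF ab]) (auto intro: subgroup_centr centr_sym)
      then show "k \<in> K" using k unfolding K_def by auto
    qed
    show "card (centr x \<inter> P) \<le> card (centr a \<inter> P)" if "a \<in> A" for a
      using cjs[OF that] card_centr_cj[OF xc] by auto
    obtain a where a: "a \<in> A" using A(1) by fastforce
    obtain g where g: "g \<in> carrier G" "a = cj g x" using cjs[OF a] by auto
    obtain b where b: "b \<in> A" "b \<noteq> a"
    proof -
      have "\<not> A \<subseteq> {a}"
      proof
        assume "A \<subseteq> {a}"
        then have "card A \<le> 1" using card_mono[of "{a}" A] by simp
        then show False using A(1) prime_p by (simp add: prime_gt_0_nat)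
      qed
      then show ?thesis using that by auto
    qed
    \<comment> \<open>\<open>K\<close> lies in the centralizer of \<open>b\<close> but
      \<open>a\<close> does not, so the translates of \<open>K\<close> by powers of \<open>a\<close>
      are disjoint; they all stay in the petal of \<open>a\<close>.\<close>
    have "p * card K \<le> card (centr a \<inter> P)"
    proof (rule cosets_card[OF subgroup_centr[OF Ac[OF b(1)]] AP[OF a] aK[OF b(1) a]])
      show "a \<noteq> b" using b by simp
      show "K \<subseteq> centr b" using b A(2) Hc P_carrier unfolding K_def by (auto simp: centr_def)
      show "finite (centr a \<inter> P)" using finite_P by simp
      fix i :: nat and s assume s: "s \<in> K"
      have sc: "s \<in> P" "s \<in> carrier G" "a \<in> centr s" using s a A(2) P_carrier unfolding K_def by auto
      have ai: "a [^] i \<in> centr s"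
        by (rule pow_closed_subgroup[OF subgroup_centr[OF sc(2)] sc(3)])
      have aa: "a [^] i \<in> centr a" "s \<in> centr a"
        using pow_closed_subgroup[OF subgroup_centr, of a a] Ac[OF a] sc(2,3)
        by (auto simp: centr_def)
      have "s \<in> centr (a [^] i)" by (rule centr_sym[OF sc(2) ai])
      then have "a [^] i \<otimes> s \<in> P"
        by (rule commuting_P_mult[OF P_pow[OF AP[OF a]] sc(1)])
      moreover have "a [^] i \<otimes> s \<in> centr a"
        by (rule subgroup.m_closed[OF subgroup_centr[OF Ac[OF a]] aa])
      ultimately show "a [^] i \<otimes> s \<in> centr a \<inter> P" by simp
    qed
    also have "\<dots> \<le> card (centr (cj (inv g) a) \<inter> P)"
      using card_centr_cj[OF Ac[OF a], of "inv g"] g by simp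
    also have "cj (inv g) a = x" using g xc by simp
    finally show "p * card K \<le> card (centr x \<inter> P)" .
  qed auto
qed

text \<open>A second sunflower, with kernel \<open>U\<close> and the petals \<open>ext U a\<close>,
  each of size at least \<open>p * card U\<close>.\<close>

lemma card_p_core:
  assumes "\<not> P \<subseteq> p_core (carrier G)"
  shows "p ^ 2 * card (p_core (carrier G)) \<le> card P"
proof -
  define U where "U = p_core (carrier G)"
  have sU: "subgroup U G" "U \<subseteq> P" and Uinv: "\<And>g u. g \<in> carrier G \<Longrightarrow> u \<in> U \<Longrightarrow> cj g u \<in> U"
    unfolding U_def using subgroup_p_core p_core_P p_core_cj subgroup_self by auto
  obtain y where y: "y \<in> P" "y \<notin> U" using assms U_def by auto
  have yc: "y \<in> carrier G" using y P_carrier by auto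
  obtain m where "y [^] (p ^ m) = \<one>" using y mem_P_iff by auto
  then have ex: "y [^] (p ^ m) \<in> U" using subgroup.one_closed[OF sU(1)] by simp
  \<comment> \<open>The minimality of \<open>n\<close> makes \<open>x\<close> an element outside
    \<open>U\<close> whose \<open>p\<close>-th power is in \<open>U\<close>, so a power of a
    conjugate \<open>a\<close> lies in \<open>U\<close> only if \<open>p\<close> divides the
    exponent.\<close>
  define n where "n = (LEAST m. y [^] (p ^ m) \<in> U)"
  have n: "y [^] (p ^ n) \<in> U" unfolding n_def using ex by (rule LeastI)
  have "n \<noteq> 0" using n y yc by (intro notI) auto
  then obtain k where k: "n = Suc k" using not0_implies_Suc by blast
  define x where "x = y [^] (p ^ k)"
  have x: "x \<in> P" "x \<notin> U"
    unfolding x_def using P_pow[OF y(1)] not_less_Least[of k "\<lambda>m. y [^] (p ^ m) \<in> U"] k n_def by auto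
  have xc: "x \<in> carrier G" using x P_carrier by auto
  have xp: "x [^] p \<in> U" using n yc unfolding x_def k by (simp add: nat_pow_pow mult.commute)
  obtain H A where H: "subgroup H G" and A: "card A = p + 1" "A \<subseteq> H - p_core H"
    and cjs: "\<And>a. a \<in> A \<Longrightarrow> \<exists>g\<in>carrier G. a = cj g x"
    and gen: "\<And>a b L. a \<in> A \<Longrightarrow> b \<in> A \<Longrightarrow> a \<noteq> b \<Longrightarrow> subgroup L G \<Longrightarrow> a \<in> L \<Longrightarrow> b \<in> L \<Longrightarrow> H \<subseteq> L"
    using ex_pairwise_generating_conjugates[OF x(1)] x(2) unfolding U_def by metis
  have AP: "a \<in> P" if "a \<in> A" for a using cjs[OF that] P_cj[OF x(1)] by auto
  have Ac: "a \<in> carrier G" if "a \<in> A" for a using AP[OF that] P_carrier by auto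
  have Ap: "a [^] p \<in> U" if "a \<in> A" for a
    using cjs[OF that] Uinv[OF _ xp] xc by (auto simp flip: cj_pow)
  have AU: "a \<notin> U" if aA: "a \<in> A" for a
  proof
    assume aU: "a \<in> U"
    obtain g where g: "g \<in> carrier G" "a = cj g x" using cjs[OF aA] by auto
    then have "cj (inv g) a \<in> U" using Uinv aU by auto
    then show False using g xc x by simp
  qed
  have E: "subgroup (ext U a) G" "ext U a \<subseteq> P" "U \<subseteq> ext U a" "a \<in> ext U a" if "a \<in> A" for a
    using subgroup_ext[OF sU AP[OF that]] ext_P[OF sU AP[OF that]] base_ext[OF sU AP[OF that]]
      gen_ext[OF sU AP[OF that]] Uinv[OF Ac[OF that]] by auto
  have "p * (p * card U) \<le> card P"
  proof (rule sunflower_card[where A = A and S = "ext U" and K = U])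
    show "ext U a \<inter> ext U b \<subseteq> U" if ab: "a \<in> A" "b \<in> A" "a \<noteq> b" for a b
    proof
      fix w assume w: "w \<in> ext U a \<inter> ext U b"
      then obtain u i where u: "w = u \<otimes> a [^] (i::nat)" "u \<in> U" unfolding ext_def by auto
      have uc: "u \<in> carrier G" using u subgroup.subset[OF sU(1)] by auto
      \<comment> \<open>An exponent prime to \<open>p\<close> would put \<open>a\<close> into
        \<open>ext U b\<close> beside \<open>b\<close>. Then \<open>H\<close> would lie in this
        p-group and equal its own core, although \<open>a\<close> is outside that core.\<close>
      have "p dvd i"
      proof (rule ccontr)
        assume "\<not> p dvd i"
        then have cop: "coprime i p" using prime_p by (subst coprime_commute, intro prime_imp_coprime_nat)
        have "u \<in> ext U b" "w \<in> ext U b" using u E(3)[OF ab(2)] w by auto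
        then have "inv u \<otimes> w \<in> ext U b"
          using subgroup.m_closed[OF E(1)[OF ab(2)]] subgroup.m_inv_closed[OF E(1)[OF ab(2)]] by auto
        moreover have "inv u \<otimes> w = a [^] i" using u uc Ac[OF ab(1)] by simp
        ultimately have "a \<in> ext U b"
          using coprime_pow_mem[OF E(1)[OF ab(2)] AP[OF ab(1)] _ cop] by simp
        then have "H \<subseteq> ext U b" using gen[OF ab E(1)[OF ab(2)]] E(4)[OF ab(2)] by simp
        then have "H \<subseteq> P" using E(2)[OF ab(2)] by auto
        then show False using p_core_whole[OF H] A(2) ab by auto
      qed
      then obtain j where "i = p * j" by auto
      then have "a [^] i = (a [^] p) [^] j" using Ac[OF ab(1)] by (simp add: nat_pow_pow)
      then have "a [^] i \<in> U" using pow_closed_subgroup[OF sU(1) Ap[OF ab(1)]] by simp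
      then show "w \<in> U" using u subgroup.m_closed[OF sU(1)] by simp
    qed
    show "p * card U \<le> card (ext U a)" if "a \<in> A" for a
    proof (rule cosets_card[OF sU(1) AP[OF that] AU[OF that] subset_refl])
      show "finite (ext U a)" using E(2)[OF that] finite_P finite_subset by auto
      show "a [^] i \<otimes> s \<in> ext U a" if "s \<in> U" for i :: nat and s
        using that E(3,4)[OF \<open>a \<in> A\<close>] pow_closed_subgroup[OF E(1)[OF \<open>a \<in> A\<close>]]
          subgroup.m_closed[OF E(1)[OF \<open>a \<in> A\<close>]] by auto
    qed
  qed (use A finite_P E in auto)
  then show ?thesis unfolding U_def by (simp add: power2_eq_square mult.assoc)
qed

section \<open>From centralizer bounds to the commuting probability\<close>

lemma commuting_prob_sum:
  "commuting_prob G p = (\<Sum>x\<in>P. real (card (centr x \<inter> P))) / real (card P) ^ 2"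
proof -
  have "{(x, y) \<in> P \<times> P. x \<otimes> y = y \<otimes> x} = Sigma P (\<lambda>x. centr x \<inter> P)"
    using P_carrier by (auto simp: centr_def)
  then show ?thesis using finite_P by (simp add: commuting_prob_def card_SigmaI)
qed

lemma card_P_pos: "card P > 0"
  using one_P finite_P by (auto simp: card_gt_0_iff)

text \<open>Elements of \<open>S\<close> contribute at most \<open>n\<close> each and all others at
  most \<open>n / q\<close>. The total \<open>n * (n + (q - 1) * s) / q\<close> grows with
  \<open>s\<close>, and its value at \<open>s = n / q ^ 2\<close> gives the constant.\<close>

lemma commuting_prob_le:
  assumes S: "S \<subseteq> P" "p ^ 2 * card S \<le> card P"
    and c: "\<And>x. x \<in> P - S \<Longrightarrow> p * card (centr x \<inter> P) \<le> card P"
  shows "commuting_prob G p \<le> (real p ^ 2 + real p - 1) / real p ^ 3"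
proof -
  define n where "n = real (card P)"
  define s where "s = real (card S)"
  define q where "q = real p"
  have q: "q \<ge> 1" unfolding q_def using prime_ge_1_nat[OF prime_p] by simp
  have n: "n > 0" unfolding n_def using card_P_pos by simp
  have fS: "finite S" using S finite_P finite_subset by auto
  have sn: "q ^ 2 * s \<le> n"
    using S(2) unfolding q_def s_def n_def by (simp flip: of_nat_power of_nat_mult)
  have cardD: "real (card (P - S)) = n - s"
    unfolding n_def s_def using S fS finite_P by (simp add: card_Diff_subset of_nat_diff card_mono)
  have "(\<Sum>x\<in>P - S. real (card (centr x \<inter> P))) \<le> (\<Sum>x\<in>P - S. n / q)"
  proof (rule sum_mono)
    fix x assume "x \<in> P - S"
    from c[OF this] have "q * real (card (centr x \<inter> P)) \<le> n"
      unfolding q_def n_def by (simp flip: of_nat_mult)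
    then show "real (card (centr x \<inter> P)) \<le> n / q" using q by (simp add: field_simps)
  qed
  moreover have "(\<Sum>x\<in>S. real (card (centr x \<inter> P))) \<le> (\<Sum>x\<in>S. n)"
    unfolding n_def using finite_P by (intro sum_mono) (simp add: card_mono)
  ultimately have "(\<Sum>x\<in>P. real (card (centr x \<inter> P))) \<le> (n - s) * (n / q) + s * n"
    using sum.subset_diff[OF S(1) finite_P, of "\<lambda>x. real (card (centr x \<inter> P))"] cardD
    by (simp add: s_def)
  also have "\<dots> = n * (n + (q - 1) * s) / q" using q by (simp add: field_simps)
  also have "\<dots> \<le> n * (n + (q - 1) * (n / q ^ 2)) / q"
  proof -
    have "s \<le> n / q ^ 2" using sn q by (simp add: field_simps)
    then show ?thesis using q n by (intro divide_right_mono mult_left_mono add_left_mono) auto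
  qed
  also have "\<dots> = n ^ 2 * ((q ^ 2 + q - 1) / q ^ 3)"
    using q by (simp add: field_simps power2_eq_square power3_eq_cube)
  finally have "(\<Sum>x\<in>P. real (card (centr x \<inter> P))) \<le> (q ^ 2 + q - 1) / q ^ 3 * n ^ 2"
    by (simp add: mult.commute)
  then show ?thesis
    unfolding commuting_prob_sum using n by (simp add: pos_divide_le_eq flip: n_def q_def)
qed

section \<open>Sylow subgroups, and the case where the p-elements form a subgroup\<close>

lemma p_subgroup_card_dvd:
  assumes R: "subgroup R G" "R \<subseteq> P"
  shows "card R dvd p ^ multiplicity p (order G)"
proof -
  obtain k where k: "card R = p ^ k" using p_subgroup_card[OF R] by auto
  have "card R dvd order G" using lagrange[OF R(1)] by (metis dvd_triv_right)
  then have "k \<le> multiplicity p (order G)"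
    using k prime_p fin by (intro multiplicity_geI) (auto simp: order_gt_0_iff_finite)
  then show ?thesis using k by (simp add: le_imp_power_dvd)
qed

lemma prime_power_subgroup_subset_P:
  assumes Q: "subgroup Q G" "card Q = p ^ m"
  shows "Q \<subseteq> P"
proof
  fix x assume x: "x \<in> Q"
  interpret Q: group "G\<lparr>carrier := Q\<rparr>" using subgroup.subgroup_is_group[OF Q(1)] is_group by simp
  have "x [^]\<^bsub>G\<lparr>carrier := Q\<rparr>\<^esub> order (G\<lparr>carrier := Q\<rparr>) = \<one>"
    using Q.pow_order_eq_1[of x] x by simp
  then have "x [^] (p ^ m) = \<one>" using Q by (simp add: order_def nat_pow_consistent[symmetric])
  then show "x \<in> P" using x subgroup.subset[OF Q(1)] mem_P_iff by auto
qed

text \<open>\<open>P\<close> contains a Sylow subgroup, whose members are p-elements, and as a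
  p-subgroup it cannot be larger.\<close>

lemma sylow_subgroup_P:
  assumes P: "subgroup P G"
  shows "sylow_subgroup G p P"
proof -
  obtain m where "order G = p ^ multiplicity p (order G) * m"
    using multiplicity_dvd by (metis dvdE)
  then obtain Q where Q: "subgroup Q G" "card Q = p ^ multiplicity p (order G)"
    using sylow_thm[OF prime_p is_group _ fin] by blast
  have "card Q \<le> card P" using prime_power_subgroup_subset_P[OF Q] finite_P by (intro card_mono)
  moreover have "card P \<le> card Q"
    using p_subgroup_card_dvd[OF P] Q prime_p by (auto intro!: dvd_imp_le simp: prime_gt_0_nat)
  ultimately show ?thesis using P Q by (simp add: sylow_subgroup_def)
qed

text \<open>Every p-element \<open>y\<close> normalizes \<open>Q\<close>, so \<open>ext Q y\<close>
  is a p-subgroup containing \<open>Q\<close>; its order cannot exceed that of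
  \<open>Q\<close>.\<close>

lemma normal_sylow_eq_P:
  assumes Q: "sylow_subgroup G p Q" "Q \<lhd> G"
  shows "Q = P"
proof
  have sQ: "subgroup Q G" "card Q = p ^ multiplicity p (order G)"
    using Q by (auto simp: sylow_subgroup_def)
  show QP: "Q \<subseteq> P" by (rule prime_power_subgroup_subset_P[OF sQ])
  show "P \<subseteq> Q"
  proof
    fix y assume y: "y \<in> P"
    then have yc: "y \<in> carrier G" using P_carrier by auto
    have inv: "cj y k \<in> Q" if "k \<in> Q" for k
      unfolding cj_def using normal.inv_op_closed2[OF Q(2) yc that] .
    note E = subgroup_ext[OF sQ(1) QP y inv] ext_P[OF sQ(1) QP y inv]
      base_ext[OF sQ(1) QP y inv] gen_ext[OF sQ(1) QP y inv]
    have "finite (ext Q y)" using E(2) finite_P finite_subset by auto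
    moreover have "card (ext Q y) \<le> card Q"
      unfolding sQ(2) using p_subgroup_card_dvd[OF E(1,2)] prime_p
      by (auto intro!: dvd_imp_le simp: prime_gt_0_nat)
    ultimately have "Q = ext Q y" using E(3) by (intro card_seteq) auto
    then show "y \<in> Q" using E(4) by simp
  qed
qed

text \<open>\<open>S\<close> is the centre of \<open>P\<close>. As \<open>x\<close> is not central,
  \<open>S\<close>, \<open>centr x \<inter> P\<close> and \<open>P\<close> form a strict chain of
  subgroups; each step has index at least \<open>p\<close>, so \<open>commuting_prob_le\<close>
  applies to \<open>S\<close>.\<close>

lemma commuting_prob_le_noncommuting:
  assumes P: "subgroup P G" and x: "x \<in> P" "y \<in> P" "y \<notin> centr x"
  shows "commuting_prob G p \<le> (real p ^ 2 + real p - 1) / real p ^ 3"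
proof -
  define S where "S = {z \<in> P. P \<subseteq> centr z}"
  have c: "z \<in> carrier G" if "z \<in> P" for z using that P_carrier by auto
  have CP: "subgroup (centr z \<inter> P) G" if "z \<in> P" for z
    using subgroups_Inter_pair[OF subgroup_centr[OF c[OF that]] P] .
  have idx: "p * card (centr z \<inter> P) \<le> card P" if "z \<in> P - S" for z
    using that CP[of z] unfolding S_def by (intro index_ge_p P) auto
  have xS: "x \<in> P - S" using x unfolding S_def by auto
  have "subgroup S G"
  proof (rule finite_submonoid_subgroup)
    show "\<one> \<in> S" using one_P c unfolding S_def by (auto simp: centr_def)
    fix u v assume uv: "u \<in> S" "v \<in> S"
    have "w \<in> centr (u \<otimes> v)" if w: "w \<in> P" for w
    proof -
      have "u \<in> centr w" "v \<in> centr w" using uv w c unfolding S_def by (auto intro: centr_sym)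
      then have "u \<otimes> v \<in> centr w" using subgroup.m_closed[OF subgroup_centr[OF c[OF w]]] by simp
      then show ?thesis using c[OF w] by (simp add: centr_sym)
    qed
    then show "u \<otimes> v \<in> S" using uv subgroup.m_closed[OF P] unfolding S_def by auto
  qed (use c in \<open>auto simp: S_def\<close>)
  moreover have "S \<subset> centr x \<inter> P"
  proof
    show "S \<subseteq> centr x \<inter> P" using x c unfolding S_def by (auto intro: centr_sym)
    have "x \<in> centr x \<inter> P" using x c by (simp add: centr_def)
    then show "S \<noteq> centr x \<inter> P" using xS by auto
  qed
  ultimately have "p * card S \<le> card (centr x \<inter> P)"
    by (intro index_ge_p[OF _ CP[OF x(1)]]) auto
  then have "p * (p * card S) \<le> p * card (centr x \<inter> P)" by simp
  also have "\<dots> \<le> card P" using idx[OF xS] .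
  finally have "p ^ 2 * card S \<le> card P" by (simp add: power2_eq_square mult.assoc)
  then show ?thesis using idx by (intro commuting_prob_le[of S]) (auto simp: S_def)
qed

end

theorem theoremA:
  fixes G :: "('a, 'b) monoid_scheme" and p :: nat
  assumes "group G" and "finite (carrier G)" and "Factorial_Ring.prime p"
  shows "commuting_prob G p > (real p ^ 2 + real p - 1) / real p ^ 3 \<longleftrightarrow>
         (\<exists>P. sylow_subgroup G p P \<and> P \<lhd> G \<and> comm_group (G\<lparr>carrier := P\<rparr>))"
    (is "?lhs \<longleftrightarrow> ?rhs")
proof -
  interpret finite_group_prime G p
    using assms by (simp add: finite_group_prime_def finite_group_prime_axioms_def)
  show ?thesis
  proof
    assume gt: ?lhs
    have core: "p_elements G p \<subseteq> p_core (carrier G)"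
    proof (rule ccontr)
      assume "\<not> p_elements G p \<subseteq> p_core (carrier G)"
      then have "commuting_prob G p \<le> (real p ^ 2 + real p - 1) / real p ^ 3"
        using card_p_core card_centr_noncore p_core_P[OF subgroup_self]
        by (intro commuting_prob_le[of "p_core (carrier G)"]) auto
      then show False using gt by simp
    qed
    \<comment> \<open>The p-elements now form a subgroup, and a noncommuting pair among them would
      again force the upper bound.\<close>
    then have eq: "p_elements G p = p_core (carrier G)" using p_core_P[OF subgroup_self] by auto
    then have sub: "subgroup (p_elements G p) G" using subgroup_p_core[OF subgroup_self] by simp
    have "p_elements G p \<lhd> G"
      unfolding normal_inv_iff using sub P_cj by (auto simp: cj_def)
    moreover have "comm_group (G\<lparr>carrier := p_elements G p\<rparr>)"
    proof (rule group.group_comm_groupI)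
      show "group (G\<lparr>carrier := p_elements G p\<rparr>)" using subgroup.subgroup_is_group[OF sub is_group] .
      fix x y
      assume xy: "x \<in> carrier (G\<lparr>carrier := p_elements G p\<rparr>)" "y \<in> carrier (G\<lparr>carrier := p_elements G p\<rparr>)"
      then have "y \<in> centr x"
        using commuting_prob_le_noncommuting[OF sub, of x y] gt by force
      then show "x \<otimes>\<^bsub>G\<lparr>carrier := p_elements G p\<rparr>\<^esub> y = y \<otimes>\<^bsub>G\<lparr>carrier := p_elements G p\<rparr>\<^esub> x"
        by (simp add: centr_def)
    qed
    ultimately show ?rhs using sylow_subgroup_P[OF sub] by blast
  next
    assume ?rhs
    then obtain Q where Q: "sylow_subgroup G p Q" "Q \<lhd> G" "comm_group (G\<lparr>carrier := Q\<rparr>)" by auto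
    have "Q = p_elements G p" using normal_sylow_eq_P[OF Q(1,2)] .
    then have "x \<otimes>\<^bsub>G\<^esub> y = y \<otimes>\<^bsub>G\<^esub> x" if "x \<in> p_elements G p" "y \<in> p_elements G p" for x y
      using comm_groupE(4)[OF Q(3)] that by simp
    then have "centr x \<inter> p_elements G p = p_elements G p" if "x \<in> p_elements G p" for x
      using that P_carrier by (auto simp: centr_def)
    then have "commuting_prob G p = 1"
      unfolding commuting_prob_sum using card_P_pos by (simp add: power2_eq_square)
    moreover have "(real p ^ 2 + real p - 1) / real p ^ 3 < 1"
    proof -
      have p: "real p > 1" using prime_gt_1_nat[OF prime_p] by simp
      then have "0 < (real p - 1) ^ 2 * (real p + 1)" by simp
      also have "\<dots> = real p ^ 3 - (real p ^ 2 + real p - 1)"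
        by (simp add: power2_eq_square power3_eq_cube algebra_simps)
      finally show ?thesis using p by simp
    qed
    ultimately show ?lhs by simp
  qed
qed

end
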